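(* Let $k$ be a field, let $A_1,\dots,A_n$ be non-empty disjoint finite sets and let $T\subseteq A_1\times\cdots\times A_n$. If the rainbow ideal $I(T)$ has a linear resolution, then the free cellular complex $\tilde{\mathcal C}_{\ge 0}(T)$ is its minimal free resolution. Moreover, $\tilde{\mathcal C}_{\ge 0}(T)$ is a minimal free resolution of $I(T)$ precisely when $I(T)$ has a linear resolution.
   Context: Let $A=\bigcup_i A_i$ and let $S=k[A]$ be the polynomial ring with variables the elements of $A$. For $\mathbf a=(a_1,\dots,a_n)\in A_1\times\cdots\times A_n$ let $m(\mathbf a)=a_1a_2\cdots a_n$. The rainbow ideal $I(T)\subseteq S$ is the ideal generated by $m(\mathbf a)$, $\mathbf a\in T$. Linear resolution means here $n$-linear: the $i$-th module in the minimal graded free resolution is generated in degree $n+i$ for all $i\geq 0$. Cell complex $C(T)$: write $\Delta(V)\subseteq\mathbb R^V$ for the geometric simplex with vertex set $V$. For non-empty subsets $R_i\subseteq A_i$ ($i=1,\dots,n$), let $\Pi(R_\bullet)=\Delta(R_1)\times\cdots\times\Delta(R_n)$, a cell of dimension $\sum_i|R_i|-n$ of the polytope $\Pi(A_\bullet)=\Delta(A_1)\times\cdots\times\Delta(A_n)$. $C(T)$ is the polyhedral cell complex consisting of all cells $\Pi(R_\bullet)$ with $R_1\times\cdots\times R_n\subseteq T$. The cell $\Pi(R_\bullet)$ is labelled by the monomial $\prod_{i}\prod_{r\in R_i}r$. Free cellular complex: for $p\ge 0$, $\mathcal C_p(T)$ is the free $S$-module with basis the cells $\Pi(R_\bullet)$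 in $C(T)$ of dimension $p$, the basis element $\Pi(R_\bullet)$ having degree that of its monomial label (so total degree $p+n$); and $\mathcal C_{-1}(T)=S$. The differential $d_0$ sends the vertex $\mathbf a$ to $m(\mathbf a)$, so its image is $I(T)$. Fix a total order on each $A_i$, and order $A$ by putting $A_1$ first, then $A_2$, and so on; for $b\in R=\bigcup_i R_i$ let $\mathrm{pos}(b)$ be its position in the induced order on $R$. For $p\ge1$, $$d_p(\Pi(R_\bullet))=\sum_{i,\ |R_i|\ge 2}\ \sum_{b\in R_i}(-1)^{\mathrm{pos}(b)}\, b\cdot\Pi(R_1,\dots,R_i\setminus\{b\},\dots,R_n).$$ $\tilde{\mathcal C}_{\ge0}(T)$ denotes the complex $\mathcal C_0(T)\leftarrow\mathcal C_1(T)\leftarrow\cdots$, augmented to $I(T)$ via $d_0$. *)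

theory Defs
  imports "HOL-Library.Poly_Mapping" "HOL-Library.FuncSet" "HOL-Library.Disjoint_Sets"
begin

section \<open>Polynomial rings and ideals\<close>

text \<open>Polynomials over \<open>'k\<close> with variables in the whole type \<open>'a\<close>; monomials are exponent
  vectors of type \<open>'a \<Rightarrow>\<^sub>0 nat\<close>. The ring \<open>k[X]\<close> is the subring \<open>polys X\<close>.\<close>

type_synonym ('a, 'k) mpoly = "('a \<Rightarrow>\<^sub>0 nat) \<Rightarrow>\<^sub>0 'k"

definition polys :: "'a set \<Rightarrow> ('a, 'k::zero) mpoly set" where
  "polys X = {p. \<forall>m \<in> Poly_Mapping.keys p. Poly_Mapping.keys m \<subseteq> X}"

definition var :: "'a \<Rightarrow> ('a, 'k::zero_neq_one) mpoly" where
  "var x = Poly_Mapping.single (Poly_Mapping.single x 1) 1"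

definition total_degree :: "('a \<Rightarrow>\<^sub>0 nat) \<Rightarrow> nat" where
  "total_degree m = (\<Sum>x \<in> Poly_Mapping.keys m. Poly_Mapping.lookup m x)"

definition ideal_generated :: "'r::comm_ring_1 set \<Rightarrow> 'r set \<Rightarrow> 'r set" where
  "ideal_generated S G = {\<Sum>g\<in>F. c g * g | F c. finite F \<and> F \<subseteq> G \<and> c ` F \<subseteq> S}"


section \<open>Free modules and graded free resolutions\<close>

text \<open>For a finite set \<open>B\<close>, \<open>free_module S B\<close> consists of the coordinate vectors of the free
  \<open>S\<close>-module with basis \<open>B\<close>. For an ideal \<open>S'\<close> of \<open>S\<close>, \<open>free_module S' B\<close> is the submodule
  \<open>S' \<cdot> free_module S B\<close>. The function \<open>lin_ext B f\<close> is the \<open>S\<close>-linear map sending each basis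
  element \<open>b\<close> to the vector \<open>f b\<close>.\<close>

definition free_module :: "'r::zero set \<Rightarrow> 'b set \<Rightarrow> ('b \<Rightarrow> 'r) set" where
  "free_module S B = {v. (\<forall>b\<in>B. v b \<in> S) \<and> (\<forall>b. b \<notin> B \<longrightarrow> v b = 0)}"

definition basis_vec :: "'b \<Rightarrow> 'b \<Rightarrow> 'r::zero_neq_one" where
  "basis_vec b = (\<lambda>c. if c = b then 1 else 0)"

definition lin_ext :: "'b set \<Rightarrow> ('b \<Rightarrow> 'c \<Rightarrow> 'r::comm_ring_1) \<Rightarrow> ('b \<Rightarrow> 'r) \<Rightarrow> 'c \<Rightarrow> 'r" where
  "lin_ext B f v = (\<lambda>c. \<Sum>b\<in>B. v b * f b c)"

text \<open>A sequence of finitely generated free \<open>k[X]\<close>-modules \<open>F\<^sub>p\<close> is given by bases \<open>B p\<close>, with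
  differential \<open>F\<^sub>p \<rightarrow> F\<^sub>p\<^sub>-\<^sub>1\<close> (\<open>p \<ge> 1\<close>) determined by \<open>d p\<close> on \<open>B p\<close>, and
  augmentation \<open>F\<^sub>0 \<rightarrow> I\<close> determined by \<open>\<epsilon>\<close> on \<open>B 0\<close>. The value \<open>d 0\<close> is not used.\<close>

definition free_resolution ::
  "'a set \<Rightarrow> ('a, 'k::field) mpoly set \<Rightarrow> (nat \<Rightarrow> 'b set) \<Rightarrow> ('b \<Rightarrow> ('a, 'k) mpoly) \<Rightarrow>
   (nat \<Rightarrow> 'b \<Rightarrow> 'b \<Rightarrow> ('a, 'k) mpoly) \<Rightarrow> bool" where
  "free_resolution X I B \<epsilon> d \<longleftrightarrow>
     (\<forall>p. finite (B p)) \<and>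
     (\<forall>b \<in> B 0. \<epsilon> b \<in> polys X) \<and>
     (\<forall>p. \<forall>b \<in> B (Suc p). d (Suc p) b \<in> free_module (polys X) (B p)) \<and>
     (\<lambda>v. \<Sum>b \<in> B 0. v b * \<epsilon> b) ` free_module (polys X) (B 0) = I \<and>
     {v \<in> free_module (polys X) (B 0). (\<Sum>b \<in> B 0. v b * \<epsilon> b) = 0}
       = lin_ext (B 1) (d 1) ` free_module (polys X) (B 1) \<and>
     (\<forall>p \<ge> 1. {v \<in> free_module (polys X) (B p). lin_ext (B p) (d p) v = (\<lambda>_. 0)}
       = lin_ext (B (Suc p)) (d (Suc p)) ` free_module (polys X) (B (Suc p)))"

text \<open>Gradings: \<open>gr\<close> is the degree of a monomial (\<open>total_degree\<close> for the standard grading, the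
  identity for the fine multigrading), and \<open>deg p b\<close> is the degree of the basis element
  \<open>b \<in> B p\<close>. All maps are homogeneous of degree zero.\<close>

definition graded_maps ::
  "(('a \<Rightarrow>\<^sub>0 nat) \<Rightarrow> 'g::comm_monoid_add) \<Rightarrow> (nat \<Rightarrow> 'b set) \<Rightarrow> (nat \<Rightarrow> 'b \<Rightarrow> 'g) \<Rightarrow>
   ('b \<Rightarrow> ('a, 'k::field) mpoly) \<Rightarrow> (nat \<Rightarrow> 'b \<Rightarrow> 'b \<Rightarrow> ('a, 'k) mpoly) \<Rightarrow> bool" where
  "graded_maps gr B deg \<epsilon> d \<longleftrightarrow>
     (\<forall>b \<in> B 0. \<forall>m \<in> Poly_Mapping.keys (\<epsilon> b). gr m = deg 0 b) \<and>
     (\<forall>p. \<forall>b \<in> B (Suc p). \<forall>c \<in> B p. \<forall>m \<in> Poly_Mapping.keys (d (Suc p) b c).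
        gr m + deg p c = deg (Suc p) b)"

text \<open>Minimality: the image of each \<open>F\<^sub>p\<^sub>+\<^sub>1 \<rightarrow> F\<^sub>p\<close> lies in \<open>\<mm> F\<^sub>p\<close>, where
  \<open>\<mm>\<close> is the ideal of \<open>k[X]\<close> generated by the variables.\<close>

definition minimal_maps ::
  "'a set \<Rightarrow> (nat \<Rightarrow> 'b set) \<Rightarrow> (nat \<Rightarrow> 'b \<Rightarrow> 'b \<Rightarrow> ('a, 'k::field) mpoly) \<Rightarrow> bool" where
  "minimal_maps X B d \<longleftrightarrow>
     (\<forall>p. lin_ext (B (Suc p)) (d (Suc p)) ` free_module (polys X) (B (Suc p))
        \<subseteq> free_module (ideal_generated (polys X) (var ` X)) (B p))"

definition minimal_graded_free_resolution ::
  "(('a \<Rightarrow>\<^sub>0 nat) \<Rightarrow> 'g::comm_monoid_add) \<Rightarrow> 'a set \<Rightarrow> ('a, 'k::field) mpoly set \<Rightarrow>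
   (nat \<Rightarrow> 'b set) \<Rightarrow> (nat \<Rightarrow> 'b \<Rightarrow> 'g) \<Rightarrow> ('b \<Rightarrow> ('a, 'k) mpoly) \<Rightarrow>
   (nat \<Rightarrow> 'b \<Rightarrow> 'b \<Rightarrow> ('a, 'k) mpoly) \<Rightarrow> bool" where
  "minimal_graded_free_resolution gr X I B deg \<epsilon> d \<longleftrightarrow>
     free_resolution X I B \<epsilon> d \<and> graded_maps gr B deg \<epsilon> d \<and> minimal_maps X B d"

text \<open>Bases of finitely generated modules are finite, so labelling them by natural numbers is no
  restriction. The minimal graded free resolution is unique up to isomorphism, so it is enough to
  ask for one whose \<open>i\<close>-th module is generated in degree \<open>n + i\<close>.\<close>

definition has_linear_resolution ::
  "nat \<Rightarrow> 'a set \<Rightarrow> ('a, 'k::field) mpoly set \<Rightarrow> bool" where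
  "has_linear_resolution n X I \<longleftrightarrow>
     (\<exists>(B :: nat \<Rightarrow> nat set) deg \<epsilon> d.
        minimal_graded_free_resolution total_degree X I B deg \<epsilon> d \<and>
        (\<forall>i. \<forall>b \<in> B i. deg i b = n + i))"


section \<open>Rainbow ideals\<close>

text \<open>The product \<open>A\<^sub>1 \<times> \<dots> \<times> A\<^sub>n\<close> is \<open>\<Pi>\<^sub>E i\<in>{1..n}. A i\<close>.\<close>

definition rainbow_monomial :: "nat \<Rightarrow> (nat \<Rightarrow> 'a) \<Rightarrow> ('a, 'k::field) mpoly" where
  "rainbow_monomial n a = (\<Prod>i\<in>{1..n}. var (a i))"

definition rainbow_ideal ::
  "nat \<Rightarrow> (nat \<Rightarrow> 'a set) \<Rightarrow> (nat \<Rightarrow> 'a) set \<Rightarrow> ('a, 'k::field) mpoly set" where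
  "rainbow_ideal n A T =
     ideal_generated (polys (\<Union>i\<in>{1..n}. A i)) (rainbow_monomial n ` T)"


section \<open>The cell complex and its free cellular complex\<close>

text \<open>A cell \<open>\<Delta>(R\<^sub>1) \<times> \<dots> \<times> \<Delta>(R\<^sub>n)\<close> is represented by the family \<open>R\<close>
  (\<open>undefined\<close> outside \<open>{1..n}\<close>), which it determines since all \<open>R i\<close> are non-empty.\<close>

definition cell_dim :: "nat \<Rightarrow> (nat \<Rightarrow> 'a set) \<Rightarrow> nat" where
  "cell_dim n R = (\<Sum>i\<in>{1..n}. card (R i)) - n"

definition cell_complex ::
  "nat \<Rightarrow> (nat \<Rightarrow> 'a set) \<Rightarrow> (nat \<Rightarrow> 'a) set \<Rightarrow> (nat \<Rightarrow> 'a set) set" where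
  "cell_complex n A T =
     {R \<in> \<Pi>\<^sub>E i\<in>{1..n}. {Q. Q \<subseteq> A i \<and> Q \<noteq> {}}. (\<Pi>\<^sub>E i\<in>{1..n}. R i) \<subseteq> T}"

definition cells ::
  "nat \<Rightarrow> (nat \<Rightarrow> 'a set) \<Rightarrow> (nat \<Rightarrow> 'a) set \<Rightarrow> nat \<Rightarrow> (nat \<Rightarrow> 'a set) set" where
  "cells n A T p = {R \<in> cell_complex n A T. cell_dim n R = p}"

text \<open>Exponent vector of the monomial label \<open>\<Prod>\<^sub>i \<Prod>\<^sub>r\<^sub>\<in>\<^sub>R\<^sub>i r\<close>.\<close>

definition cell_label :: "nat \<Rightarrow> (nat \<Rightarrow> 'a set) \<Rightarrow> 'a \<Rightarrow>\<^sub>0 nat" where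
  "cell_label n R = (\<Sum>i\<in>{1..n}. \<Sum>r\<in>R i. Poly_Mapping.single r 1)"

text \<open>The order on \<open>\<Union>i. A i\<close> putting \<open>A 1\<close> first, then \<open>A 2\<close>, and so on, each \<open>A i\<close> being
  ordered by the (reflexive) relation \<open>le i\<close>. Positions are counted from 1.\<close>

definition block_order :: "nat \<Rightarrow> (nat \<Rightarrow> 'a set) \<Rightarrow> (nat \<Rightarrow> 'a rel) \<Rightarrow> 'a rel" where
  "block_order n A le = {(x, y). \<exists>i\<in>{1..n}. \<exists>j\<in>{1..n}. x \<in> A i \<and> y \<in> A j \<and>
     (i < j \<or> i = j \<and> (x, y) \<in> le i)}"

definition pos ::
  "nat \<Rightarrow> (nat \<Rightarrow> 'a set) \<Rightarrow> (nat \<Rightarrow> 'a rel) \<Rightarrow> (nat \<Rightarrow> 'a set) \<Rightarrow> 'a \<Rightarrow> nat" where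
  "pos n A le R b = card {c \<in> (\<Union>i\<in>{1..n}. R i). (c, b) \<in> block_order n A le}"

text \<open>The vertex \<open>a\<close> is the cell with \<open>R i = {a i}\<close>.\<close>

definition cellular_aug :: "nat \<Rightarrow> (nat \<Rightarrow> 'a set) \<Rightarrow> ('a, 'k::field) mpoly" where
  "cellular_aug n R = rainbow_monomial n (\<lambda>i\<in>{1..n}. the_elem (R i))"

definition cellular_diff ::
  "nat \<Rightarrow> (nat \<Rightarrow> 'a set) \<Rightarrow> (nat \<Rightarrow> 'a rel) \<Rightarrow> (nat \<Rightarrow> 'a set) \<Rightarrow>
   (nat \<Rightarrow> 'a set) \<Rightarrow> ('a, 'k::field) mpoly" where
  "cellular_diff n A le R = (\<lambda>Q. \<Sum>i\<in>{i\<in>{1..n}. card (R i) \<ge> 2}. \<Sum>b\<in>R i.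
     (-1) ^ pos n A le R b * var b * basis_vec (R(i := R i - {b})) Q)"

text \<open>The complex \<open>\<C>\<^sub>0 \<leftarrow> \<C>\<^sub>1 \<leftarrow> \<dots>\<close> with its augmentation to \<open>I(T)\<close>,
  multigraded by the monomial labels.\<close>

definition cellular_complex_is_minimal_free_resolution ::
  "nat \<Rightarrow> (nat \<Rightarrow> 'a set) \<Rightarrow> (nat \<Rightarrow> 'a rel) \<Rightarrow> (nat \<Rightarrow> 'a) set \<Rightarrow>
   ('a, 'k::field) mpoly set \<Rightarrow> bool" where
  "cellular_complex_is_minimal_free_resolution n A le T I \<longleftrightarrow>
     minimal_graded_free_resolution (\<lambda>m. m) (\<Union>i\<in>{1..n}. A i) I
       (cells n A T) (\<lambda>_. cell_label n) (cellular_aug n) (\<lambda>_. cellular_diff n A le)"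

end

theory Submission
  imports Defs
begin

text \<open>The cellular complex \<open>C\<close> always contains its own linear part: a cycle of \<open>C\<close> whose
  coefficients are linear forms is the boundary of a combination of cells with constant
  coefficients, and no nonzero combination of cells with constant coefficients is a cycle. A linear
  resolution \<open>F\<close> of the ideal has the first property as well, by exactness. Hence the
  identity of the ideal lifts to chain maps \<open>F \<rightarrow> C\<close> and \<open>C \<rightarrow> F\<close> with constant matrix entries,
  the composite \<open>C \<rightarrow> F \<rightarrow> C\<close> is the identity by the second property, and \<open>C\<close> inherits
  exactness from \<open>F\<close>. Conversely \<open>C\<close> is generated in the degrees required of a linear
  resolution.\<close>

section \<open>Homogeneous polynomials\<close>

text \<open>For general \<open>T\<close> the complex is not exact, so its exactness has to be
  borrowed from the given resolution. The comparison works because the p-th modules of both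
  complexes are generated in degree \<open>n + p\<close>: a map of degree zero between them has
  constant entries, and lifting it one step further only asks for preimages of cycles with linear
  coefficients. That these are boundaries for every \<open>T\<close> is a multigraded computation.
  In a squarefree multidegree \<open>M\<close>, the relations at the faces of codimension two (for
  \<open>p = 0\<close>, the augmentation) force all coefficients to agree up to the sign of the
  boundary; a multidegree that is not squarefree contributes nothing. If the common value is
  nonzero, all facets of \<open>M\<close> meeting every block are cells. Then \<open>M\<close> is a
  cell, since it has more than \<open>n\<close> elements and every choice of one element per block
  already lies in such a facet. Minimality costs nothing, as all entries of the differential are
  signed variables, so in both directions the issue is exactness alone.\<close>

lemma lookup_mult_single:
  fixes f :: "('m::cancel_comm_monoid_add) \<Rightarrow>\<^sub>0 ('c::comm_semiring_1)"
  shows "Poly_Mapping.lookup (f * Poly_Mapping.single m a) (k + m) = Poly_Mapping.lookup f k * a"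
proof (induction f rule: Poly_Mapping.update_induct)
  case const
  show ?case by simp
next
  case (update f l b)
  have eq: "Poly_Mapping.update l b f = f + Poly_Mapping.single l b"
    using update(1)
    by (intro poly_mapping_eqI)
      (auto simp: lookup_update lookup_add lookup_single when_def in_keys_iff)
  show ?case
    unfolding eq using update(3)
    by (auto simp: algebra_simps lookup_add mult_single lookup_single when_def)
qed

lemma lookup_mult_single_eq_0:
  fixes f :: "('m::cancel_comm_monoid_add) \<Rightarrow>\<^sub>0 ('c::comm_semiring_1)"
  assumes "\<And>k. t \<noteq> k + m"
  shows "Poly_Mapping.lookup (f * Poly_Mapping.single m a) t = 0"
proof (rule ccontr)
  assume "Poly_Mapping.lookup (f * Poly_Mapping.single m a) t \<noteq> 0"
  then have "t \<in> Poly_Mapping.keys (f * Poly_Mapping.single m a)" by (simp add: in_keys_iff)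
  then obtain k where "t = k + m"
    using keys_mult[of f "Poly_Mapping.single m a"] by (auto split: if_splits)
  then show False using assms by blast
qed

lemma lookup_minus_one_power_mult:
  fixes f :: "('m::monoid_add) \<Rightarrow>\<^sub>0 ('c::comm_ring_1)"
  shows "Poly_Mapping.lookup ((- 1) ^ k * f) t = (- 1) ^ k * Poly_Mapping.lookup f t"
  by (cases "even k") auto

lemma total_degree_superset:
  assumes "finite S" "Poly_Mapping.keys m \<subseteq> S"
  shows "total_degree m = (\<Sum>x\<in>S. Poly_Mapping.lookup m x)"
  unfolding total_degree_def
  by (rule sum.mono_neutral_left) (use assms in \<open>auto simp: in_keys_iff\<close>)

lemma total_degree_add: "total_degree (m + k) = total_degree m + total_degree k"
proof -
  let ?S = "Poly_Mapping.keys m \<union> Poly_Mapping.keys k"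
  have "Poly_Mapping.keys (m + k) \<subseteq> ?S" by (rule Poly_Mapping.keys_add)
  then show ?thesis
    by (simp add: total_degree_superset[of ?S] lookup_add sum.distrib)
qed

lemma total_degree_0 [simp]: "total_degree 0 = 0"
  by (simp add: total_degree_def)

lemma total_degree_single [simp]: "total_degree (Poly_Mapping.single x k) = k"
  by (simp add: total_degree_def)

lemma total_degree_eq_0_iff [simp]: "total_degree m = 0 \<longleftrightarrow> m = 0"
  by (auto simp: total_degree_def in_keys_iff intro!: poly_mapping_eqI)

lemma total_degree_eq_1:
  assumes "total_degree m = 1"
  shows "\<exists>x. m = Poly_Mapping.single x 1"
proof -
  obtain x where x: "x \<in> Poly_Mapping.keys m" "Poly_Mapping.lookup m x = 1"
    "\<And>y. y \<in> Poly_Mapping.keys m \<Longrightarrow> y \<noteq> x \<Longrightarrow> Poly_Mapping.lookup m y = 0"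
    using assms unfolding total_degree_def
    by (metis One_nat_def finite_keys sum_eq_1_iff)
  then have "m = Poly_Mapping.single x 1"
    by (intro poly_mapping_eqI) (auto simp: lookup_single when_def in_keys_iff)
  then show ?thesis ..
qed

lemma polys_0 [simp]: "0 \<in> polys X"
  by (simp add: polys_def)

lemma polys_add: "p \<in> polys X \<Longrightarrow> q \<in> polys X \<Longrightarrow> p + q \<in> polys X"
  using Poly_Mapping.keys_add[of p q] by (auto simp: polys_def)

lemma polys_mult:
  fixes p q :: "('a, 'k::field) mpoly"
  assumes "p \<in> polys X" "q \<in> polys X"
  shows "p * q \<in> polys X"
  unfolding polys_def
proof (intro CollectI ballI)
  fix m assume "m \<in> Poly_Mapping.keys (p * q)"
  then obtain a b where "m = a + b" "a \<in> Poly_Mapping.keys p" "b \<in> Poly_Mapping.keys q"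
    using keys_mult[of p q] by blast
  then show "Poly_Mapping.keys m \<subseteq> X"
    using assms Poly_Mapping.keys_add[of a b] unfolding polys_def by blast
qed

lemma polys_uminus: "(p :: ('a, 'k::field) mpoly) \<in> polys X \<Longrightarrow> - p \<in> polys X"
  by (auto simp: polys_def in_keys_iff)

lemma polys_sum: "(\<And>i. i \<in> J \<Longrightarrow> f i \<in> polys X) \<Longrightarrow> (\<Sum>i\<in>J. f i) \<in> polys X"
  by (induction J rule: infinite_finite_induct) (auto intro: polys_add)

lemma polys_minus_one_power:
  fixes p :: "('a, 'k::field) mpoly"
  shows "p \<in> polys X \<Longrightarrow> (- 1) ^ k * p \<in> polys X"
  by (cases "even k") (auto intro: polys_uminus)

definition hom_polys :: "'a set \<Rightarrow> nat \<Rightarrow> ('a, 'k::field) mpoly set" where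
  "hom_polys X k = {p \<in> polys X. \<forall>m \<in> Poly_Mapping.keys p. total_degree m = k}"

lemma hom_polys_0 [simp]: "0 \<in> hom_polys X k"
  by (simp add: hom_polys_def)

lemma hom_polys_subset: "hom_polys X k \<subseteq> polys X"
  by (auto simp: hom_polys_def)

lemma hom_polys_add: "p \<in> hom_polys X k \<Longrightarrow> q \<in> hom_polys X k \<Longrightarrow> p + q \<in> hom_polys X k"
  using Poly_Mapping.keys_add[of p q] by (auto simp: hom_polys_def polys_add)

lemma hom_polys_uminus: "p \<in> hom_polys X k \<Longrightarrow> - p \<in> hom_polys X k"
  by (auto simp: hom_polys_def polys_uminus in_keys_iff)

lemma hom_polys_diff: "p \<in> hom_polys X k \<Longrightarrow> q \<in> hom_polys X k \<Longrightarrow> p - q \<in> hom_polys X k"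
  using hom_polys_add[of p X k "- q"] hom_polys_uminus[of q X k] by simp

lemma hom_polys_sum: "(\<And>i. i \<in> J \<Longrightarrow> f i \<in> hom_polys X k) \<Longrightarrow> (\<Sum>i\<in>J. f i) \<in> hom_polys X k"
  by (induction J rule: infinite_finite_induct) (auto intro: hom_polys_add)

lemma hom_polys_mult:
  assumes "p \<in> hom_polys X k" "q \<in> hom_polys X l"
  shows "p * q \<in> hom_polys X (k + l)"
proof -
  have "total_degree m = k + l" if "m \<in> Poly_Mapping.keys (p * q)" for m
    using that keys_mult[of p q] assms by (force simp: hom_polys_def total_degree_add)
  then show ?thesis
    using assms by (simp add: hom_polys_def polys_mult)
qed

lemma single_0_hom_polys [simp]: "Poly_Mapping.single 0 a \<in> hom_polys X 0"
  by (auto simp: hom_polys_def polys_def)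

lemma hom_polys_0D: "p \<in> hom_polys X 0 \<Longrightarrow> p = Poly_Mapping.single 0 (Poly_Mapping.lookup p 0)"
  by (rule poly_mapping_eqI) (auto simp: hom_polys_def lookup_single when_def in_keys_iff)

text \<open>A non-constant monomial of \<open>p\<close> pushes every term of \<open>q\<close> beyond
  degree \<open>k\<close>, so in degree \<open>k\<close> only the constant coefficient of
  \<open>p\<close> is seen.\<close>

lemma lookup_mult_hom:
  assumes "q \<in> hom_polys X k" "total_degree t = k"
  shows "Poly_Mapping.lookup (p * q) t = Poly_Mapping.lookup p 0 * Poly_Mapping.lookup q t"
proof -
  let ?c = "Poly_Mapping.single 0 (Poly_Mapping.lookup p 0)"
  have "Poly_Mapping.lookup ((p - ?c) * q) t = 0"
  proof (rule ccontr)
    assume "Poly_Mapping.lookup ((p - ?c) * q) t \<noteq> 0"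
    then have "t \<in> Poly_Mapping.keys ((p - ?c) * q)" by (simp add: in_keys_iff)
    then obtain a b where ab: "t = a + b" "a \<in> Poly_Mapping.keys (p - ?c)" "b \<in> Poly_Mapping.keys q"
      using keys_mult by blast
    have "total_degree a = 0"
      using assms ab by (auto simp: hom_polys_def total_degree_add)
    then have "a = 0" by simp
    then show False using ab(2) by (simp add: in_keys_iff lookup_minus)
  qed
  then have "Poly_Mapping.lookup (p * q) t = Poly_Mapping.lookup (q * ?c) (t + 0)"
    by (simp add: left_diff_distrib lookup_minus mult.commute[of q])
  then show ?thesis
    by (simp only: lookup_mult_single mult.commute)
qed

text \<open>Comparing the parts of degree \<open>k\<close> replaces each coefficient by its constant
  term. In this way polynomial preimages are turned into preimages with entries in the
  field.\<close>

lemma hom_combination_const: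
  assumes "w \<in> hom_polys X k" and "\<And>b. b \<in> B \<Longrightarrow> f b \<in> hom_polys X k"
    and "w = (\<Sum>b\<in>B. v b * f b)"
  shows "w = (\<Sum>b\<in>B. Poly_Mapping.single 0 (Poly_Mapping.lookup (v b) 0) * f b)" (is "_ = ?u")
proof -
  have u: "?u \<in> hom_polys X k"
    by (rule hom_polys_sum) (use assms(2) hom_polys_mult[OF single_0_hom_polys] in force)
  show ?thesis
  proof (rule poly_mapping_eqI)
    fix t
    show "Poly_Mapping.lookup w t = Poly_Mapping.lookup ?u t"
    proof (cases "total_degree t = k")
      case True
      have "Poly_Mapping.lookup w t = (\<Sum>b\<in>B. Poly_Mapping.lookup (v b * f b) t)"
        by (simp add: assms(3) lookup_sum)
      also have "\<dots> = (\<Sum>b\<in>B. Poly_Mapping.lookup (Poly_Mapping.single 0 (Poly_Mapping.lookup (v b) 0) * f b) t)"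
        by (rule sum.cong) (use assms(2) True in \<open>simp_all add: lookup_mult_hom[where X = X and k = k]\<close>)
      finally show ?thesis by (simp add: lookup_sum)
    next
      case False
      then have "t \<notin> Poly_Mapping.keys w" "t \<notin> Poly_Mapping.keys ?u"
        using assms(1) u by (auto simp: hom_polys_def)
      then show ?thesis by (simp add: in_keys_iff)
    qed
  qed
qed

section \<open>Complexes with linear differentials\<close>

lemma free_module_hom_subset: "v \<in> free_module (hom_polys X k) B \<Longrightarrow> v \<in> free_module (polys X) B"
  using hom_polys_subset by (fastforce simp: free_module_def)

lemma lin_ext_polys:
  fixes f :: "'b \<Rightarrow> 'c \<Rightarrow> ('a, 'k::field) mpoly"
  assumes "\<And>b. b \<in> B \<Longrightarrow> f b \<in> free_module (polys X) C" "v \<in> free_module (polys X) B"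
  shows "lin_ext B f v \<in> free_module (polys X) C"
  using assms unfolding free_module_def lin_ext_def
  by (auto intro!: polys_sum polys_mult sum.neutral)

lemma lin_ext_hom:
  fixes f :: "'b \<Rightarrow> 'c \<Rightarrow> ('a, 'k::field) mpoly"
  assumes "\<And>b. b \<in> B \<Longrightarrow> f b \<in> free_module (hom_polys X l) C" "v \<in> free_module (hom_polys X k) B"
  shows "lin_ext B f v \<in> free_module (hom_polys X (k + l)) C"
  using assms unfolding free_module_def lin_ext_def
  by (auto intro!: hom_polys_sum hom_polys_mult sum.neutral)

text \<open>A single exchange of sums serves for both kinds of composition: directly for the
  augmentation, and coordinate by coordinate for a further linear map.\<close>

lemma sum_lin_ext: "(\<Sum>c\<in>C. lin_ext B f v c * e c) = (\<Sum>b\<in>B. v b * (\<Sum>c\<in>C. f b c * e c))"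
  unfolding lin_ext_def sum_distrib_left sum_distrib_right
  by (subst sum.swap) (simp add: mult.assoc)

lemma lin_ext_lin_ext: "lin_ext C g (lin_ext B f v) = lin_ext B (\<lambda>b. lin_ext C g (f b)) v"
proof
  fix x
  show "lin_ext C g (lin_ext B f v) x = lin_ext B (\<lambda>b. lin_ext C g (f b)) v x"
    unfolding lin_ext_def[of C] by (subst sum_lin_ext) (simp add: lin_ext_def)
qed

lemma lin_ext_cong: "(\<And>b. b \<in> B \<Longrightarrow> f b = g b) \<Longrightarrow> lin_ext B f v = lin_ext B g v"
  by (auto simp: lin_ext_def intro!: sum.cong)

lemma lin_ext_zero [simp]: "lin_ext B f (\<lambda>_. 0) = (\<lambda>_. 0)"
  by (simp add: lin_ext_def)

lemma lin_ext_diff: "lin_ext B f (\<lambda>b. v b - w b) = (\<lambda>c. lin_ext B f v c - lin_ext B f w c)"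
  by (simp add: lin_ext_def left_diff_distrib sum_subtractf)

lemma sum_basis_vec:
  "finite B \<Longrightarrow> b \<in> B \<Longrightarrow> (\<Sum>c\<in>B. basis_vec b c * e c) = (e b :: 'r::comm_ring_1)"
  by (simp add: basis_vec_def if_distrib[of "\<lambda>x. x * _"] cong: if_cong)

lemma lin_ext_basis_vec: "finite B \<Longrightarrow> b \<in> B \<Longrightarrow> lin_ext B f (basis_vec b) = f b"
  by (simp add: lin_ext_def sum_basis_vec)

lemma lin_ext_basis_vec_id:
  assumes "finite B" "v \<in> free_module S B"
  shows "lin_ext B basis_vec v = v"
proof
  fix c
  have "lin_ext B basis_vec v c = (\<Sum>b\<in>B. if b = c then v c else 0)"
    unfolding lin_ext_def by (rule sum.cong) (auto simp: basis_vec_def)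
  also have "\<dots> = v c" using assms by (auto simp: free_module_def)
  finally show "lin_ext B basis_vec v c = v c" .
qed

lemma basis_vec_free_module_hom: "b \<in> B \<Longrightarrow> basis_vec b \<in> free_module (hom_polys X 0) B"
  using single_0_hom_polys[where a = 1] by (auto simp: free_module_def basis_vec_def)

lemma free_module_hom_diff:
  "v \<in> free_module (hom_polys X k) B \<Longrightarrow> w \<in> free_module (hom_polys X k) B \<Longrightarrow>
   (\<lambda>b. v b - w b) \<in> free_module (hom_polys X k) B"
  by (auto simp: free_module_def hom_polys_diff)

text \<open>In degree 0 the augmentation takes the place of the differential, so that exactness has
  the same form in all degrees.\<close>

definition cycles ::
  "'a set \<Rightarrow> (nat \<Rightarrow> 'b set) \<Rightarrow> ('b \<Rightarrow> ('a, 'k::field) mpoly) \<Rightarrow>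
   (nat \<Rightarrow> 'b \<Rightarrow> 'b \<Rightarrow> ('a, 'k) mpoly) \<Rightarrow> nat \<Rightarrow> ('b \<Rightarrow> ('a, 'k) mpoly) set" where
  "cycles X B \<epsilon> d p = {v \<in> free_module (polys X) (B p).
     case p of 0 \<Rightarrow> (\<Sum>b \<in> B 0. v b * \<epsilon> b) = 0 | Suc _ \<Rightarrow> lin_ext (B p) (d p) v = (\<lambda>_. 0)}"

lemma free_resolution_iff_cycles:
  "free_resolution X I B \<epsilon> d \<longleftrightarrow>
     (\<forall>p. finite (B p)) \<and>
     (\<forall>b \<in> B 0. \<epsilon> b \<in> polys X) \<and>
     (\<forall>p. \<forall>b \<in> B (Suc p). d (Suc p) b \<in> free_module (polys X) (B p)) \<and>
     (\<lambda>v. \<Sum>b \<in> B 0. v b * \<epsilon> b) ` free_module (polys X) (B 0) = I \<and>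
     (\<forall>p. cycles X B \<epsilon> d p = lin_ext (B (Suc p)) (d (Suc p)) ` free_module (polys X) (B (Suc p)))"
proof -
  have eq: "(\<forall>p. P p) \<longleftrightarrow> P 0 \<and> (\<forall>p\<ge>1. P p)" for P :: "nat \<Rightarrow> bool"
    by (metis less_one not_less)
  have c0: "cycles X B \<epsilon> d 0 = {v \<in> free_module (polys X) (B 0). (\<Sum>b \<in> B 0. v b * \<epsilon> b) = 0}"
    by (simp add: cycles_def)
  have c1: "p \<ge> 1 \<Longrightarrow> cycles X B \<epsilon> d p =
      {v \<in> free_module (polys X) (B p). lin_ext (B p) (d p) v = (\<lambda>_. 0)}" for p
    by (cases p) (auto simp: cycles_def)
  show ?thesis
    unfolding free_resolution_def
    by (subst eq[where P = "\<lambda>p. cycles X B \<epsilon> d p = _ p"]) (simp add: c0 c1)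
qed

text \<open>The common ground of the cellular complex and of a linear resolution. Exactness is
  demanded only of cycles whose coefficients are linear forms, which is all that lifting a map with
  constant entries asks for.\<close>

locale linear_complex =
  fixes n :: nat and X :: "'a set" and B :: "nat \<Rightarrow> 'b set"
    and \<epsilon> :: "'b \<Rightarrow> ('a, 'k::field) mpoly"
    and d :: "nat \<Rightarrow> 'b \<Rightarrow> 'b \<Rightarrow> ('a, 'k) mpoly"
  assumes fin: "finite (B p)"
    and aug_hom: "b \<in> B 0 \<Longrightarrow> \<epsilon> b \<in> hom_polys X n"
    and diff_linear: "b \<in> B (Suc p) \<Longrightarrow> d (Suc p) b \<in> free_module (hom_polys X 1) (B p)"
    and diff_cycle: "b \<in> B (Suc p) \<Longrightarrow> d (Suc p) b \<in> cycles X B \<epsilon> d p"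
    and linear_cycle: "z \<in> cycles X B \<epsilon> d p \<Longrightarrow> z \<in> free_module (hom_polys X 1) (B p) \<Longrightarrow>
      \<exists>c \<in> free_module (hom_polys X 0) (B (Suc p)). lin_ext (B (Suc p)) (d (Suc p)) c = z"

text \<open>A chain map over the identity of the ideal, with all matrix entries in degree 0.\<close>

definition scalar_chain_map where
  "scalar_chain_map X B \<epsilon> d B' \<epsilon>' d' \<phi> \<longleftrightarrow>
     (\<forall>p. \<forall>b \<in> B p. \<phi> p b \<in> free_module (hom_polys X 0) (B' p)) \<and>
     (\<forall>b \<in> B 0. (\<Sum>c \<in> B' 0. \<phi> 0 b c * \<epsilon>' c) = \<epsilon> b) \<and>
     (\<forall>p. \<forall>b \<in> B (Suc p).
        lin_ext (B' (Suc p)) (d' (Suc p)) (\<phi> (Suc p) b) = lin_ext (B p) (\<phi> p) (d (Suc p) b))"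

lemma scalar_chain_map_cycles:
  assumes "scalar_chain_map X B \<epsilon> d B' \<epsilon>' d' \<phi>" "v \<in> cycles X B \<epsilon> d p"
  shows "lin_ext (B p) (\<phi> p) v \<in> cycles X B' \<epsilon>' d' p"
proof -
  have "lin_ext (B p) (\<phi> p) v \<in> free_module (polys X) (B' p)"
    using assms by (intro lin_ext_polys) (auto simp: scalar_chain_map_def cycles_def
        intro: free_module_hom_subset)
  moreover have "(\<Sum>c \<in> B' 0. lin_ext (B 0) (\<phi> 0) v c * \<epsilon>' c) = 0" if "p = 0"
  proof -
    have "(\<Sum>c \<in> B' 0. lin_ext (B 0) (\<phi> 0) v c * \<epsilon>' c) = (\<Sum>b \<in> B 0. v b * \<epsilon> b)"
      using assms(1) by (simp add: sum_lin_ext scalar_chain_map_def)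
    then show ?thesis using assms(2) that by (simp add: cycles_def)
  qed
  moreover have "lin_ext (B' p) (d' p) (lin_ext (B p) (\<phi> p) v) = (\<lambda>_. 0)" if "p = Suc q" for q
  proof -
    have "lin_ext (B' p) (d' p) (lin_ext (B p) (\<phi> p) v) = lin_ext (B p) (\<lambda>b. lin_ext (B q) (\<phi> q) (d p b)) v"
      unfolding lin_ext_lin_ext
      by (rule lin_ext_cong) (use assms(1) that in \<open>simp add: scalar_chain_map_def\<close>)
    also have "\<dots> = lin_ext (B q) (\<phi> q) (lin_ext (B p) (d p) v)"
      by (simp add: lin_ext_lin_ext)
    also have "\<dots> = (\<lambda>_. 0)"
      using assms(2) that by (simp add: cycles_def)
    finally show ?thesis .
  qed
  ultimately show ?thesis by (auto simp: cycles_def split: nat.split)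
qed

text \<open>The usual comparison argument. A matrix of constants sends \<open>d (Suc p) b\<close> to
  a cycle with linear coefficients; \<open>linear_cycle\<close> lifts it, and the lift is again
  constant.\<close>

lemma (in linear_complex) ex_scalar_chain_map:
  assumes "linear_complex n X B' \<epsilon>' d'"
    and aug: "\<And>b. b \<in> B 0 \<Longrightarrow> \<exists>c \<in> free_module (hom_polys X 0) (B' 0). (\<Sum>x \<in> B' 0. c x * \<epsilon>' x) = \<epsilon> b"
  shows "\<exists>\<phi>. scalar_chain_map X B \<epsilon> d B' \<epsilon>' d' \<phi>"
proof -
  interpret C: linear_complex n X B' \<epsilon>' d' by fact
  \<comment> \<open>The choice in degree \<open>Suc p\<close> sees only the map \<open>f\<close> in
    degree \<open>p\<close>, so \<open>P\<close> also records what the earlier squares imply: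
    \<open>f\<close> sends cycles to cycles.\<close>
  define P where "P p f \<longleftrightarrow> (\<forall>b \<in> B p. f b \<in> free_module (hom_polys X 0) (B' p)) \<and>
      (p = 0 \<longrightarrow> (\<forall>b \<in> B 0. (\<Sum>c \<in> B' 0. f b c * \<epsilon>' c) = \<epsilon> b)) \<and>
      (\<forall>v \<in> cycles X B \<epsilon> d p. lin_ext (B p) f v \<in> cycles X B' \<epsilon>' d' p)" for p f
  define Q where "Q p f g \<longleftrightarrow> (\<forall>b \<in> B (Suc p).
      lin_ext (B' (Suc p)) (d' (Suc p)) (g b) = lin_ext (B p) f (d (Suc p) b))" for p f g
  have "\<exists>\<phi>. \<forall>p. P p (\<phi> p) \<and> Q p (\<phi> p) (\<phi> (Suc p))"
  proof (rule dependent_nat_choice)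
    obtain f where f: "\<forall>b \<in> B 0. f b \<in> free_module (hom_polys X 0) (B' 0) \<and>
        (\<Sum>c \<in> B' 0. f b c * \<epsilon>' c) = \<epsilon> b"
      using aug by metis
    have "lin_ext (B 0) f v \<in> cycles X B' \<epsilon>' d' 0" if "v \<in> cycles X B \<epsilon> d 0" for v
    proof -
      have "lin_ext (B 0) f v \<in> free_module (polys X) (B' 0)"
        using f that by (intro lin_ext_polys) (auto simp: cycles_def intro: free_module_hom_subset)
      moreover have "(\<Sum>c \<in> B' 0. lin_ext (B 0) f v c * \<epsilon>' c) = (\<Sum>b \<in> B 0. v b * \<epsilon> b)"
        using f by (simp add: sum_lin_ext)
      ultimately show ?thesis using that by (simp add: cycles_def)
    qed
    then show "\<exists>f. P 0 f" using f by (auto simp: P_def)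
  next
    fix f p assume f: "P p f"
    have "\<exists>c \<in> free_module (hom_polys X 0) (B' (Suc p)).
        lin_ext (B' (Suc p)) (d' (Suc p)) c = lin_ext (B p) f (d (Suc p) b)" if "b \<in> B (Suc p)" for b
    proof (rule C.linear_cycle)
      show "lin_ext (B p) f (d (Suc p) b) \<in> cycles X B' \<epsilon>' d' p"
        using f diff_cycle[OF that] by (simp add: P_def)
      have "lin_ext (B p) f (d (Suc p) b) \<in> free_module (hom_polys X (1 + 0)) (B' p)"
        by (rule lin_ext_hom) (use f diff_linear[OF that] in \<open>auto simp: P_def\<close>)
      then show "lin_ext (B p) f (d (Suc p) b) \<in> free_module (hom_polys X 1) (B' p)" by simp
    qed
    then obtain g where g: "\<forall>b \<in> B (Suc p). g b \<in> free_module (hom_polys X 0) (B' (Suc p)) \<and>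
        lin_ext (B' (Suc p)) (d' (Suc p)) (g b) = lin_ext (B p) f (d (Suc p) b)"
      by metis
    have "lin_ext (B (Suc p)) g v \<in> cycles X B' \<epsilon>' d' (Suc p)" if "v \<in> cycles X B \<epsilon> d (Suc p)" for v
    proof -
      have "lin_ext (B (Suc p)) g v \<in> free_module (polys X) (B' (Suc p))"
        using g that by (intro lin_ext_polys) (auto simp: cycles_def intro: free_module_hom_subset)
      moreover have "lin_ext (B' (Suc p)) (d' (Suc p)) (lin_ext (B (Suc p)) g v)
          = lin_ext (B (Suc p)) (\<lambda>b. lin_ext (B p) f (d (Suc p) b)) v"
        unfolding lin_ext_lin_ext by (rule lin_ext_cong) (use g in simp)
      moreover have "\<dots> = lin_ext (B p) f (lin_ext (B (Suc p)) (d (Suc p)) v)"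
        by (simp add: lin_ext_lin_ext)
      moreover have "\<dots> = (\<lambda>_. 0)" using that by (simp add: cycles_def)
      ultimately show ?thesis by (simp add: cycles_def)
    qed
    then show "\<exists>g. P (Suc p) g \<and> Q p f g" using g by (auto simp: P_def Q_def)
  qed
  then obtain \<phi> where "\<And>p. P p (\<phi> p)" "\<And>p. Q p (\<phi> p) (\<phi> (Suc p))"
    by blast
  then have "scalar_chain_map X B \<epsilon> d B' \<epsilon>' d' \<phi>"
    unfolding scalar_chain_map_def P_def Q_def by simp
  then show ?thesis by blast
qed

text \<open>Composing comparison maps \<open>C \<rightarrow> F \<rightarrow> C\<close> gives the identity, because the absence of
  nonzero constant cycles makes lifts unique; hence \<open>C\<close> inherits exactness from \<open>F\<close>.\<close>

lemma (in linear_complex) cycles_eq_boundaries_if_resolution: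
  assumes const_cycle: "\<And>p v. v \<in> cycles X B \<epsilon> d p \<Longrightarrow> v \<in> free_module (hom_polys X 0) (B p) \<Longrightarrow> v = (\<lambda>_. 0)"
    and F: "linear_complex n X B' \<epsilon>' d'"
    and exact: "\<And>p. cycles X B' \<epsilon>' d' p \<subseteq> lin_ext (B' (Suc p)) (d' (Suc p)) ` free_module (polys X) (B' (Suc p))"
    and \<phi>: "scalar_chain_map X B' \<epsilon>' d' B \<epsilon> d \<phi>"
    and \<psi>: "scalar_chain_map X B \<epsilon> d B' \<epsilon>' d' \<psi>"
  shows "cycles X B \<epsilon> d p = lin_ext (B (Suc p)) (d (Suc p)) ` free_module (polys X) (B (Suc p))"
proof -
  have \<psi>0: "\<psi> p b \<in> free_module (hom_polys X 0) (B' p)" if "b \<in> B p" for p b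
    using \<psi> that by (simp add: scalar_chain_map_def)
  have \<phi>0: "\<phi> p b \<in> free_module (hom_polys X 0) (B p)" if "b \<in> B' p" for p b
    using \<phi> that by (simp add: scalar_chain_map_def)
  \<comment> \<open>The defect of the composite from the identity on generators. Its entries are
    constants, so it vanishes as soon as it is shown to be a cycle.\<close>
  define h where "h p b = (\<lambda>c. lin_ext (B' p) (\<phi> p) (\<psi> p b) c - basis_vec b c)" for p b
  have h0: "h p b \<in> free_module (hom_polys X 0) (B p)" if "b \<in> B p" for p b
    unfolding h_def using lin_ext_hom[OF \<phi>0 \<psi>0[OF that]] basis_vec_free_module_hom[OF that]
    by (intro free_module_hom_diff) auto
  have id: "lin_ext (B' p) (\<phi> p) (\<psi> p b) = basis_vec b" if "b \<in> B p" for p b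
    using that
  proof (induction p arbitrary: b)
    case 0
    have "(\<Sum>x \<in> B 0. lin_ext (B' 0) (\<phi> 0) (\<psi> 0 b) x * \<epsilon> x) = (\<Sum>x \<in> B' 0. \<psi> 0 b x * \<epsilon>' x)"
      using \<phi> by (simp add: sum_lin_ext scalar_chain_map_def)
    also have "\<dots> = \<epsilon> b" using \<psi> 0 by (simp add: scalar_chain_map_def)
    finally have "(\<Sum>x \<in> B 0. h 0 b x * \<epsilon> x) = 0"
      using 0 by (simp add: h_def left_diff_distrib sum_subtractf sum_basis_vec fin)
    then have "h 0 b \<in> cycles X B \<epsilon> d 0"
      using free_module_hom_subset[OF h0[OF 0]] by (simp add: cycles_def)
    from const_cycle[OF this h0[OF 0]] show ?case by (simp add: h_def fun_eq_iff)
  next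
    case (Suc p)
    let ?d = "lin_ext (B (Suc p)) (d (Suc p))"
    have "?d (lin_ext (B' (Suc p)) (\<phi> (Suc p)) (\<psi> (Suc p) b))
        = lin_ext (B' (Suc p)) (\<lambda>b. lin_ext (B' p) (\<phi> p) (d' (Suc p) b)) (\<psi> (Suc p) b)"
      unfolding lin_ext_lin_ext
      by (rule lin_ext_cong) (use \<phi> in \<open>simp add: scalar_chain_map_def\<close>)
    also have "\<dots> = lin_ext (B' p) (\<phi> p) (lin_ext (B' (Suc p)) (d' (Suc p)) (\<psi> (Suc p) b))"
      by (simp add: lin_ext_lin_ext)
    also have "\<dots> = lin_ext (B' p) (\<phi> p) (lin_ext (B p) (\<psi> p) (d (Suc p) b))"
      using \<psi> Suc.prems by (simp add: scalar_chain_map_def)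
    also have "\<dots> = lin_ext (B p) basis_vec (d (Suc p) b)"
      unfolding lin_ext_lin_ext by (rule lin_ext_cong) (simp add: Suc.IH)
    also have "\<dots> = d (Suc p) b"
      by (rule lin_ext_basis_vec_id[OF fin diff_linear[OF Suc.prems]])
    finally have "?d (h (Suc p) b) = (\<lambda>_. 0)"
      using Suc.prems by (simp add: h_def lin_ext_diff lin_ext_basis_vec fin)
    then have "h (Suc p) b \<in> cycles X B \<epsilon> d (Suc p)"
      using free_module_hom_subset[OF h0[OF Suc.prems]] by (simp add: cycles_def)
    from const_cycle[OF this h0[OF Suc.prems]] show ?case by (simp add: h_def fun_eq_iff)
  qed
  show ?thesis
  proof (intro equalityI subsetI)
    fix z assume z: "z \<in> cycles X B \<epsilon> d p"
    then have "lin_ext (B p) (\<psi> p) z \<in> cycles X B' \<epsilon>' d' p"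
      by (rule scalar_chain_map_cycles[OF \<psi>])
    then obtain y where y: "y \<in> free_module (polys X) (B' (Suc p))"
      "lin_ext (B p) (\<psi> p) z = lin_ext (B' (Suc p)) (d' (Suc p)) y"
      using exact by blast
    \<comment> \<open>The cycle makes a round trip through the resolution, where it is the boundary
      of \<open>y\<close>; the image of \<open>y\<close> under \<open>\<phi>\<close> is then a
      preimage of \<open>z\<close>.\<close>
    have "z = lin_ext (B p) basis_vec z"
      using z lin_ext_basis_vec_id[OF fin, of z "polys X" p] by (simp add: cycles_def)
    also have "\<dots> = lin_ext (B' p) (\<phi> p) (lin_ext (B p) (\<psi> p) z)"
      unfolding lin_ext_lin_ext by (rule lin_ext_cong) (simp add: id)
    also have "\<dots> = lin_ext (B' (Suc p)) (\<lambda>b. lin_ext (B' p) (\<phi> p) (d' (Suc p) b)) y"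
      by (simp add: y(2) lin_ext_lin_ext)
    also have "\<dots> = lin_ext (B (Suc p)) (d (Suc p)) (lin_ext (B' (Suc p)) (\<phi> (Suc p)) y)"
      unfolding lin_ext_lin_ext
      by (rule lin_ext_cong) (use \<phi> in \<open>simp add: scalar_chain_map_def\<close>)
    finally show "z \<in> lin_ext (B (Suc p)) (d (Suc p)) ` free_module (polys X) (B (Suc p))"
      using lin_ext_polys[where f = "\<phi> (Suc p)", OF free_module_hom_subset[OF \<phi>0] y(1)]
      by blast
  next
    fix z assume "z \<in> lin_ext (B (Suc p)) (d (Suc p)) ` free_module (polys X) (B (Suc p))"
    then obtain v where v: "v \<in> free_module (polys X) (B (Suc p))"
      and z: "z = lin_ext (B (Suc p)) (d (Suc p)) v" by blast
    have dc: "d (Suc p) b \<in> cycles X B \<epsilon> d p" if "b \<in> B (Suc p)" for b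
      using diff_cycle[OF that] .
    have "z \<in> free_module (polys X) (B p)"
      unfolding z using dc by (intro lin_ext_polys[OF _ v]) (simp add: cycles_def)
    moreover have "(\<Sum>b \<in> B 0. z b * \<epsilon> b) = 0" if "p = 0"
      using dc that by (simp add: z sum_lin_ext cycles_def)
    moreover have "lin_ext (B p) (d p) z = (\<lambda>_. 0)" if "p = Suc q" for q
    proof -
      have "lin_ext (B p) (d p) z = lin_ext (B (Suc p)) (\<lambda>_ _. 0) v"
        unfolding z lin_ext_lin_ext by (rule lin_ext_cong) (use dc that in \<open>simp add: cycles_def\<close>)
      then show ?thesis by (simp add: lin_ext_def)
    qed
    ultimately show "z \<in> cycles X B \<epsilon> d p" by (auto simp: cycles_def split: nat.split)
  qed
qed

lemma const_part_free_module:
  "(\<lambda>b. if b \<in> B then Poly_Mapping.single 0 (Poly_Mapping.lookup (v b) 0) else 0) \<in> free_module (hom_polys X 0) B"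
  by (simp add: free_module_def)

text \<open>Generators in degrees \<open>n + i\<close> force the entries of \<open>d\<close> to be
  linear forms. A linear cycle has some preimage \<open>v\<close> by exactness, and comparing parts
  of degree 1 shows that the constant terms of \<open>v\<close> already form a preimage.\<close>

lemma linear_resolution_linear_complex:
  fixes B :: "nat \<Rightarrow> 'b set" and \<epsilon> :: "'b \<Rightarrow> ('a, 'k::field) mpoly"
  assumes "free_resolution X I B \<epsilon> d" "graded_maps total_degree B deg \<epsilon> d"
    and deg: "\<And>i b. b \<in> B i \<Longrightarrow> deg i b = n + i"
  shows "linear_complex n X B \<epsilon> d"
proof
  note res = assms(1)[unfolded free_resolution_iff_cycles]
  show "finite (B p)" for p using res by blast
  show "\<epsilon> b \<in> hom_polys X n" if "b \<in> B 0" for b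
    using res assms(2) deg[OF that] that by (auto simp: hom_polys_def graded_maps_def)
  show lin: "d (Suc p) b \<in> free_module (hom_polys X 1) (B p)" if b: "b \<in> B (Suc p)" for p b
  proof -
    have "d (Suc p) b \<in> free_module (polys X) (B p)" using res b by blast
    moreover have "total_degree m = 1" if "c \<in> B p" "m \<in> Poly_Mapping.keys (d (Suc p) b c)" for c m
    proof -
      have "total_degree m + deg p c = deg (Suc p) b"
        using assms(2) b that by (simp add: graded_maps_def)
      then show ?thesis using deg[OF b] deg[OF that(1)] by simp
    qed
    ultimately show ?thesis by (simp add: free_module_def hom_polys_def)
  qed
  show "d (Suc p) b \<in> cycles X B \<epsilon> d p" if b: "b \<in> B (Suc p)" for p b
  proof -
    have "d (Suc p) b = lin_ext (B (Suc p)) (d (Suc p)) (basis_vec b)"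
      using res b by (simp add: lin_ext_basis_vec)
    then show ?thesis
      using res free_module_hom_subset[OF basis_vec_free_module_hom[OF b]] by blast
  qed
  show "\<exists>c \<in> free_module (hom_polys X 0) (B (Suc p)). lin_ext (B (Suc p)) (d (Suc p)) c = z"
    if z: "z \<in> cycles X B \<epsilon> d p" "z \<in> free_module (hom_polys X 1) (B p)" for p z
  proof -
    obtain v where v: "z = lin_ext (B (Suc p)) (d (Suc p)) v" using res z by blast
    let ?c = "\<lambda>b. if b \<in> B (Suc p) then Poly_Mapping.single 0 (Poly_Mapping.lookup (v b) 0) else 0"
    have "lin_ext (B (Suc p)) (d (Suc p)) ?c x = z x" for x
    proof -
      have "z x = (\<Sum>b\<in>B (Suc p). Poly_Mapping.single 0 (Poly_Mapping.lookup (v b) 0) * d (Suc p) b x)"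
      proof (rule hom_combination_const)
        show "z x \<in> hom_polys X 1" using z(2) by (cases "x \<in> B p") (auto simp: free_module_def)
        show "d (Suc p) b x \<in> hom_polys X 1" if "b \<in> B (Suc p)" for b
          using lin[OF that] by (cases "x \<in> B p") (auto simp: free_module_def)
      qed (simp add: v lin_ext_def)
      then show ?thesis by (simp add: lin_ext_def)
    qed
    then show ?thesis using const_part_free_module by blast
  qed
qed

lemma (in linear_complex) free_resolution_if_linear_resolution:
  assumes const_cycle: "\<And>p v. v \<in> cycles X B \<epsilon> d p \<Longrightarrow> v \<in> free_module (hom_polys X 0) (B p) \<Longrightarrow> v = (\<lambda>_. 0)"
    and I: "(\<lambda>v. \<Sum>b \<in> B 0. v b * \<epsilon> b) ` free_module (polys X) (B 0) = I"
    and lin: "has_linear_resolution n X I"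
  shows "free_resolution X I B \<epsilon> d"
proof -
  obtain B' :: "nat \<Rightarrow> nat set" and deg \<epsilon>' d' where
    F: "minimal_graded_free_resolution total_degree X I B' deg \<epsilon>' d'"
    and deg: "\<forall>i. \<forall>b \<in> B' i. deg i b = n + i"
    using lin unfolding has_linear_resolution_def by blast
  have res: "free_resolution X I B' \<epsilon>' d'" using F by (simp add: minimal_graded_free_resolution_def)
  have F': "linear_complex n X B' \<epsilon>' d'"
    using F deg by (intro linear_resolution_linear_complex[where deg = deg])
      (auto simp: minimal_graded_free_resolution_def)
  interpret F: linear_complex n X B' \<epsilon>' d' by (fact F')
  have I': "(\<lambda>v. \<Sum>b \<in> B' 0. v b * \<epsilon>' b) ` free_module (polys X) (B' 0) = I"
    using res by (simp add: free_resolution_def)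
  \<comment> \<open>Both augmentations have image \<open>I\<close> and generators of degree
    \<open>n\<close>. Hence a generator of either complex is a combination of those of the other
    with constant coefficients, which starts both comparison maps.\<close>
  have gen: "\<exists>c \<in> free_module (hom_polys X 0) G. (\<Sum>x \<in> G. c x * e x) = w"
    if w: "w \<in> hom_polys X n" and e: "\<And>b. b \<in> G \<Longrightarrow> e b \<in> hom_polys X n"
      and im: "w \<in> (\<lambda>v. \<Sum>b \<in> G. v b * e b) ` free_module (polys X) G" for G :: "'c set" and e :: "'c \<Rightarrow> ('a, 'k) mpoly" and w
  proof -
    obtain v where v: "w = (\<Sum>b \<in> G. v b * e b)" using im by blast
    have "w = (\<Sum>b\<in>G. Poly_Mapping.single 0 (Poly_Mapping.lookup (v b) 0) * e b)"
      by (rule hom_combination_const[OF w _ v]) (rule e)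
    also have "\<dots> = (\<Sum>b\<in>G. (if b \<in> G then Poly_Mapping.single 0 (Poly_Mapping.lookup (v b) 0) else 0) * e b)"
      by simp
    finally show ?thesis
      by (intro bexI[OF _ const_part_free_module[where v = v]]) (rule sym)
  qed
  have mem: "e b \<in> (\<lambda>v. \<Sum>b \<in> G. v b * e b) ` free_module (polys X) G"
    if "finite G" "b \<in> G" for G :: "'c set" and e :: "'c \<Rightarrow> ('a, 'k) mpoly" and b
    by (rule image_eqI[of _ _ "basis_vec b"])
      (simp_all add: sum_basis_vec[OF that] free_module_hom_subset[OF basis_vec_free_module_hom[OF that(2)]])
  have "\<exists>c \<in> free_module (hom_polys X 0) (B 0). (\<Sum>x \<in> B 0. c x * \<epsilon> x) = \<epsilon>' b" if "b \<in> B' 0" for b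
    using mem[OF F.fin that, of \<epsilon>'] I I' by (intro gen F.aug_hom[OF that] aug_hom) auto
  then obtain \<phi> where \<phi>: "scalar_chain_map X B' \<epsilon>' d' B \<epsilon> d \<phi>"
    using F.ex_scalar_chain_map[OF linear_complex_axioms] by blast
  have "\<exists>c \<in> free_module (hom_polys X 0) (B' 0). (\<Sum>x \<in> B' 0. c x * \<epsilon>' x) = \<epsilon> b" if "b \<in> B 0" for b
    using mem[OF fin that, of \<epsilon>] I I' by (intro gen aug_hom[OF that] F.aug_hom) auto
  then obtain \<psi> where \<psi>: "scalar_chain_map X B \<epsilon> d B' \<epsilon>' d' \<psi>"
    using ex_scalar_chain_map[OF F'] by blast
  have "cycles X B \<epsilon> d p = lin_ext (B (Suc p)) (d (Suc p)) ` free_module (polys X) (B (Suc p))" for p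
    using res by (intro cycles_eq_boundaries_if_resolution[OF const_cycle F' _ \<phi> \<psi>])
      (auto simp: free_resolution_iff_cycles)
  then show ?thesis
    using fin aug_hom hom_polys_subset diff_linear free_module_hom_subset I
    by (fastforce simp: free_resolution_iff_cycles)
qed

section \<open>Subsets meeting every block\<close>

definition set_monom :: "'a set \<Rightarrow> 'a \<Rightarrow>\<^sub>0 nat" where
  "set_monom U = (\<Sum>x\<in>U. Poly_Mapping.single x 1)"

lemma lookup_set_monom:
  "finite U \<Longrightarrow> Poly_Mapping.lookup (set_monom U) x = (if x \<in> U then 1 else 0)"
  by (simp add: set_monom_def lookup_sum lookup_single when_def)

lemma set_monom_remove:
  "finite U \<Longrightarrow> x \<in> U \<Longrightarrow> set_monom U = Poly_Mapping.single x 1 + set_monom (U - {x})"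
  by (simp add: set_monom_def sum.remove)

lemma set_monom_inject:
  assumes "finite U" "finite V" "set_monom U = set_monom V"
  shows "U = V"
proof -
  have "x \<in> U \<longleftrightarrow> x \<in> V" for x
    using arg_cong[OF assms(3), of "\<lambda>m. Poly_Mapping.lookup m x"] assms(1,2)
    by (auto simp: lookup_set_monom split: if_splits)
  then show ?thesis by blast
qed

lemma keys_set_monom: "finite U \<Longrightarrow> Poly_Mapping.keys (set_monom U) = U"
  by (auto simp: in_keys_iff lookup_set_monom split: if_splits)

lemma total_degree_set_monom: "finite U \<Longrightarrow> total_degree (set_monom U) = card U"
  by (simp add: total_degree_def keys_set_monom lookup_set_monom)

lemma prod_var: "(\<Prod>x\<in>U. var x :: ('a, 'k::field) mpoly) = Poly_Mapping.single (set_monom U) 1"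
  by (induction U rule: infinite_finite_induct) (simp_all add: set_monom_def var_def mult_single)

lemma lookup_mult_var:
  fixes f :: "('a, 'k::field) mpoly"
  shows "Poly_Mapping.lookup (f * var y) (k + Poly_Mapping.single y 1) = Poly_Mapping.lookup f k"
  unfolding var_def by (simp only: lookup_mult_single mult_1_right)

lemma lookup_mult_var_eq_0:
  fixes f :: "('a, 'k::field) mpoly"
  assumes "Poly_Mapping.lookup t y = 0"
  shows "Poly_Mapping.lookup (f * var y) t = 0"
  unfolding var_def
proof (rule lookup_mult_single_eq_0)
  show "t \<noteq> k + Poly_Mapping.single y 1" for k
    using assms by (auto simp: lookup_add)
qed

lemma lookup_mult_var_single:
  fixes f :: "('a, 'k::field) mpoly"
  shows "Poly_Mapping.lookup (f * var y) (Poly_Mapping.single x 1)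
    = (if y = x then Poly_Mapping.lookup f 0 else 0)"
  using lookup_mult_var[of f x 0]
  by (auto intro!: lookup_mult_var_eq_0 simp: lookup_single when_def)

text \<open>Boundaries of chains with linear coefficients are read off in the multidegree
  \<open>x y\<close>, which is divisible by no other variables than \<open>x\<close> and
  \<open>y\<close>.\<close>

lemma lookup_mult_var_pair:
  fixes f :: "('a, 'k::field) mpoly"
  assumes "x \<noteq> y"
  shows "Poly_Mapping.lookup (f * var b) (Poly_Mapping.single x 1 + Poly_Mapping.single y 1)
    = (if b = x then Poly_Mapping.lookup f (Poly_Mapping.single y 1)
       else if b = y then Poly_Mapping.lookup f (Poly_Mapping.single x 1) else 0)"
proof -
  have "Poly_Mapping.lookup (f * var x) (Poly_Mapping.single x 1 + Poly_Mapping.single y 1)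
      = Poly_Mapping.lookup f (Poly_Mapping.single y 1)"
    by (subst add.commute) (rule lookup_mult_var)
  moreover have "Poly_Mapping.lookup (f * var y) (Poly_Mapping.single x 1 + Poly_Mapping.single y 1)
      = Poly_Mapping.lookup f (Poly_Mapping.single x 1)"
    by (rule lookup_mult_var)
  ultimately show ?thesis
    using assms by (auto intro!: lookup_mult_var_eq_0 simp: lookup_single lookup_add when_def)
qed

text \<open>Exchanging the summation variables would only show that twice the sum is zero. Splitting
  the pairs by the order \<open>r\<close> lets the two halves cancel, which is valid in
  characteristic 2 as well.\<close>

lemma sum_antisymmetric:
  fixes f :: "'i \<Rightarrow> 'i \<Rightarrow> 'r::ab_group_add"
  assumes "finite Y"
    and tot: "\<And>x y. x \<in> Y \<Longrightarrow> y \<in> Y \<Longrightarrow> x \<noteq> y \<Longrightarrow> (x, y) \<in> r \<longleftrightarrow> (y, x) \<notin> r"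
    and f: "\<And>x y. x \<in> Y \<Longrightarrow> y \<in> Y \<Longrightarrow> x \<noteq> y \<Longrightarrow> f x y = - f y x"
  shows "(\<Sum>y\<in>Y. \<Sum>x\<in>Y - {y}. f y x) = 0"
proof -
  let ?g = "\<lambda>y x. if x \<noteq> y \<and> (x, y) \<in> r then f y x else 0"
  let ?h = "\<lambda>y x. if x \<noteq> y \<and> (y, x) \<in> r then f y x else 0"
  have "(\<Sum>y\<in>Y. \<Sum>x\<in>Y - {y}. f y x) = (\<Sum>y\<in>Y. \<Sum>x\<in>Y. ?g y x + ?h y x)"
  proof (rule sum.cong[OF refl])
    fix y assume y: "y \<in> Y"
    have "(\<Sum>x\<in>Y - {y}. f y x) = (\<Sum>x\<in>Y - {y}. ?g y x + ?h y x)"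
      by (rule sum.cong) (use tot y in auto)
    also have "\<dots> = (\<Sum>x\<in>Y. ?g y x + ?h y x)"
      by (rule sum.mono_neutral_left) (use assms(1) in auto)
    finally show "(\<Sum>x\<in>Y - {y}. f y x) = (\<Sum>x\<in>Y. ?g y x + ?h y x)" .
  qed
  also have "\<dots> = (\<Sum>y\<in>Y. \<Sum>x\<in>Y. ?g y x) + (\<Sum>y\<in>Y. \<Sum>x\<in>Y. ?h y x)"
    by (simp add: sum.distrib)
  also have "(\<Sum>y\<in>Y. \<Sum>x\<in>Y. ?h y x) = (\<Sum>x\<in>Y. \<Sum>y\<in>Y. ?h y x)"
    by (rule sum.swap)
  also have "(\<Sum>y\<in>Y. \<Sum>x\<in>Y. ?g y x) + \<dots> = (\<Sum>y\<in>Y. \<Sum>x\<in>Y. ?g y x + ?h x y)"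
    by (simp add: sum.distrib)
  also have "\<dots> = 0"
  proof (intro sum.neutral ballI)
    fix x y assume "x \<in> Y" "y \<in> Y"
    then show "?g y x + ?h x y = 0" using f[of y x] by (cases "x = y") simp_all
  qed
  finally show ?thesis .
qed

text \<open>The relation \<open>r\<close> abstracts the block order to the facts behind the signs.
  By \<open>r_block\<close>, no element of another block lies between two elements of the same
  block; by \<open>r_refl\<close>, positions count from 1.\<close>

locale rainbow_blocks =
  fixes n :: nat and A :: "nat \<Rightarrow> 'a set" and X :: "'a set" and r :: "'a rel"
    and T :: "(nat \<Rightarrow> 'a) set"
  assumes X_def: "X = (\<Union>i\<in>{1..n}. A i)" and finite_X: "finite X"
    and disj: "disjoint_family_on A {1..n}"
    and r_total: "x \<in> X \<Longrightarrow> y \<in> X \<Longrightarrow> x \<noteq> y \<Longrightarrow> (x, y) \<in> r \<longleftrightarrow> (y, x) \<notin> r"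
    and r_refl: "x \<in> X \<Longrightarrow> (x, x) \<in> r"
    and r_block: "i \<in> {1..n} \<Longrightarrow> j \<in> {1..n} \<Longrightarrow> i \<noteq> j \<Longrightarrow> x \<in> A i \<Longrightarrow> y \<in> A i \<Longrightarrow> c \<in> A j \<Longrightarrow>
      (c, x) \<in> r \<longleftrightarrow> (c, y) \<in> r"
begin

text \<open>A cell is encoded by the union of its parts. This turns the cellular differential into the
  simplicial one, restricted to the subsets of \<open>X\<close> meeting every block.\<close>

definition hits :: "'a set \<Rightarrow> bool" where
  "hits U \<longleftrightarrow> U \<subseteq> X \<and> (\<forall>i\<in>{1..n}. U \<inter> A i \<noteq> {})"

text \<open>Cardinality \<open>n + p\<close> means dimension \<open>p\<close>, because each of the
  \<open>n\<close> simplex factors has one vertex more than its dimension.\<close>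

definition faces :: "nat \<Rightarrow> 'a set set" where
  "faces p = {U. hits U \<and> card U = n + p \<and> (\<Pi>\<^sub>E i\<in>{1..n}. U \<inter> A i) \<subseteq> T}"

definition rk :: "'a set \<Rightarrow> 'a \<Rightarrow> nat" where
  "rk U x = card {c \<in> U. (c, x) \<in> r}"

text \<open>At most one summand is nonzero. The sum avoids naming the element of
  \<open>U - Q\<close> and lets the coefficient of a boundary at \<open>Q\<close> be expanded over
  the vertices added to \<open>Q\<close>. Sets \<open>Q\<close> missing a block get coefficient 0,
  just as the last vertex of a factor is never removed in the cellular differential.\<close>

definition bd :: "'a set \<Rightarrow> 'a set \<Rightarrow> ('a, 'k::field) mpoly" where
  "bd U Q = (if hits Q then \<Sum>x\<in>X - Q. if U = insert x Q then (- 1) ^ rk U x * var x else 0 else 0)"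

definition aug :: "'a set \<Rightarrow> ('a, 'k::field) mpoly" where
  "aug U = Poly_Mapping.single (set_monom U) 1"

lemma finite_if_subset_X: "U \<subseteq> X \<Longrightarrow> finite U"
  using finite_X finite_subset by blast

lemma finite_if_hits: "hits U \<Longrightarrow> finite U"
  by (simp add: hits_def finite_if_subset_X)

lemma hits_superset: "hits Q \<Longrightarrow> Q \<subseteq> U \<Longrightarrow> U \<subseteq> X \<Longrightarrow> hits U"
  unfolding hits_def by blast

lemma same_block: "i \<in> {1..n} \<Longrightarrow> j \<in> {1..n} \<Longrightarrow> x \<in> A i \<Longrightarrow> x \<in> A j \<Longrightarrow> i = j"
  using disj unfolding disjoint_family_on_def by blast

lemma ex_block: "hits U \<Longrightarrow> x \<in> U \<Longrightarrow> \<exists>i\<in>{1..n}. x \<in> A i"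
  using X_def unfolding hits_def by blast

lemma finite_faces: "finite (faces p)"
proof (rule finite_subset)
  show "faces p \<subseteq> Pow X" by (auto simp: faces_def hits_def)
qed (simp add: finite_X)

lemma faces_hits: "U \<in> faces p \<Longrightarrow> hits U"
  and faces_card: "U \<in> faces p \<Longrightarrow> card U = n + p"
  by (auto simp: faces_def)

lemma faces_subset_X: "U \<in> faces p \<Longrightarrow> U \<subseteq> X"
  using faces_hits hits_def by blast

lemma faces_remove:
  assumes "insert x Q \<in> faces (Suc p)" "x \<notin> Q" "hits Q"
  shows "Q \<in> faces p"
proof -
  have "card Q = n + p"
    using assms finite_if_hits[OF assms(3)] faces_card[OF assms(1)] by simp
  moreover have "(\<Pi>\<^sub>E i\<in>{1..n}. Q \<inter> A i) \<subseteq> (\<Pi>\<^sub>E i\<in>{1..n}. insert x Q \<inter> A i)"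
    by (rule PiE_mono) blast
  ultimately show ?thesis using assms by (auto simp: faces_def)
qed

section \<open>Transversals and removable vertices\<close>

definition transversal :: "(nat \<Rightarrow> 'a) \<Rightarrow> 'a set \<Rightarrow> bool" where
  "transversal a U \<longleftrightarrow> (\<forall>i\<in>{1..n}. a i \<in> U \<inter> A i)"

lemma transversal_card: 
  assumes "transversal a U"
  shows "card (a ` {1..n}) = n"
proof -
  have "inj_on a {1..n}"
    using assms same_block by (intro inj_onI) (auto simp: transversal_def, metis atLeastAtMost_iff)
  then show ?thesis by (simp add: card_image)
qed

lemma transversal_hits: "transversal a V \<Longrightarrow> a ` {1..n} \<subseteq> U \<Longrightarrow> U \<subseteq> X \<Longrightarrow> hits U"
  unfolding hits_def transversal_def by fastforce

lemma ex_transversal: "hits U \<Longrightarrow> \<exists>a. transversal a U"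
  unfolding hits_def transversal_def by (intro bchoice) blast

text \<open>The choice in the block of \<open>y\<close> is redirected to \<open>y\<close>. A vertex
  outside such a transversal is removable and differs from \<open>y\<close>.\<close>

lemma ex_transversal_through:
  assumes "hits U" "y \<in> U"
  shows "\<exists>a. transversal a U \<and> y \<in> a ` {1..n}"
proof -
  obtain a where a: "transversal a U" using ex_transversal[OF assms(1)] by blast
  obtain i where i: "i \<in> {1..n}" "y \<in> A i" using assms ex_block by blast
  have "transversal (a(i := y)) U" using a i assms by (auto simp: transversal_def)
  moreover have "y \<in> (a(i := y)) ` {1..n}" using i(1) by (auto intro!: image_eqI[of _ _ i])
  ultimately show ?thesis by blast
qed

lemma transversal_remove:
  assumes "transversal a U" "hits U" "x \<notin> a ` {1..n}"
  shows "hits (U - {x})"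
  using assms by (intro transversal_hits[of a U]) (auto simp: transversal_def hits_def)

lemma hits_card: "hits U \<Longrightarrow> n \<le> card U"
proof -
  assume U: "hits U"
  then obtain a where a: "transversal a U" using ex_transversal by blast
  then have "a ` {1..n} \<subseteq> U" by (auto simp: transversal_def)
  then show ?thesis
    using transversal_card[OF a] card_mono[OF finite_if_hits[OF U]] by metis
qed

text \<open>A transversal has only \<open>n\<close> elements and so misses some element of
  \<open>U\<close>; after the removal of that element the transversal still meets every
  block.\<close>

lemma ex_removable:
  assumes "hits U" "card U > n" "transversal a U"
  shows "\<exists>x\<in>U. x \<notin> a ` {1..n} \<and> hits (U - {x})"
proof -
  have "\<not> U \<subseteq> a ` {1..n}"
    using assms card_mono[of "a ` {1..n}" U] transversal_card[OF assms(3)] by auto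
  then show ?thesis using transversal_remove[OF assms(3,1)] by blast
qed

text \<open>Every choice of one element per block of \<open>U\<close> uses only \<open>n\<close>
  elements and therefore lives in a facet that still meets all blocks. Membership in
  \<open>T\<close> is thus decided on the facets.\<close>

lemma faces_if_all_facets:
  assumes "hits U" "card U = n + Suc p"
    and "\<And>x. x \<in> U \<Longrightarrow> hits (U - {x}) \<Longrightarrow> U - {x} \<in> faces p"
  shows "U \<in> faces (Suc p)"
proof -
  have "a \<in> T" if a: "a \<in> (\<Pi>\<^sub>E i\<in>{1..n}. U \<inter> A i)" for a
  proof -
    have tr: "transversal a U" using a by (auto simp: transversal_def)
    obtain x where x: "x \<in> U" "x \<notin> a ` {1..n}" "hits (U - {x})"
      using ex_removable[OF assms(1) _ tr] assms(2) by auto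
    have "a \<in> (\<Pi>\<^sub>E i\<in>{1..n}. (U - {x}) \<inter> A i)"
      using a x(2) by (auto simp: PiE_iff)
    then show ?thesis using assms(3)[OF x(1,3)] by (auto simp: faces_def)
  qed
  then show ?thesis using assms(1,2) by (auto simp: faces_def)
qed

text \<open>With \<open>n + 1\<close> elements in \<open>n\<close> blocks, one block contains two
  elements and each other block one. Only the two elements of the double block can be
  removed.\<close>

lemma edge_blocks:
  assumes "hits U" "card U = Suc n"
  shows "\<exists>i\<in>{1..n}. \<exists>x y. x \<noteq> y \<and> U \<inter> A i = {x, y} \<and> {w \<in> U. hits (U - {w})} = {x, y}"
proof -
  obtain a where a: "transversal a U" using ex_transversal[OF assms(1)] by blast
  have sub: "a ` {1..n} \<subseteq> U" using a by (auto simp: transversal_def)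
  obtain y where y: "y \<in> U" "y \<notin> a ` {1..n}" "hits (U - {y})"
    using ex_removable[OF assms(1) _ a] assms(2) by auto
  have "card (insert y (a ` {1..n})) = card U"
    using y(2) transversal_card[OF a] assms(2) by simp
  then have U: "U = insert y (a ` {1..n})"
    using sub y(1) finite_if_hits[OF assms(1)] by (metis card_subset_eq insert_subset)
  obtain i where i: "i \<in> {1..n}" "y \<in> A i" using y(1) assms(1) ex_block by blast
  have aA: "a j \<in> A j" if "j \<in> {1..n}" for j using a that by (auto simp: transversal_def)
  have in_block: "w = a j \<or> (w = y \<and> j = i)" if "w \<in> U" "w \<in> A j" "j \<in> {1..n}" for w j
    using that U aA same_block i by (metis imageE insertE)
  have block: "U \<inter> A i = {a i, y}"
    using in_block i U aA[OF i(1)] by auto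
  have "hits (U - {w}) \<longleftrightarrow> w \<in> {a i, y}" if w: "w \<in> U" for w
  proof
    assume h: "hits (U - {w})"
    show "w \<in> {a i, y}"
    proof (rule ccontr)
      assume nw: "w \<notin> {a i, y}"
      then obtain j where j: "j \<in> {1..n}" "w = a j" using w U by blast
      then have "(U - {w}) \<inter> A j = {}" using in_block nw by blast
      then show False using h j(1) by (auto simp: hits_def)
    qed
  next
    assume "w \<in> {a i, y}"
    \<comment> \<open>Letting block \<open>i\<close> choose \<open>y\<close> instead of
      \<open>a i\<close> gives a transversal that avoids \<open>a i\<close>.\<close>
    moreover have "hits (U - {a i})"
    proof (rule transversal_hits)
      show "transversal (a(i := y)) U" using a i y(1) by (auto simp: transversal_def)
      show "(a(i := y)) ` {1..n} \<subseteq> U - {a i}"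
      proof
        fix w assume "w \<in> (a(i := y)) ` {1..n}"
        then obtain j where j: "j \<in> {1..n}" "w = (a(i := y)) j" by blast
        show "w \<in> U - {a i}"
        proof (cases "j = i")
          case True then show ?thesis using j y i by auto
        next
          case False
          then have "a j \<noteq> a i" using same_block[OF j(1) i(1)] aA i(1) j(1) by metis
          then show ?thesis using j False U by auto
        qed
      qed
      show "U - {a i} \<subseteq> X" using assms(1) by (auto simp: hits_def)
    qed
    ultimately show "hits (U - {w})" using y(3) by blast
  qed
  moreover have "a i \<noteq> y" using y(2) i(1) by blast
  moreover have "a i \<in> U" using sub i(1) by blast
  ultimately have "{w \<in> U. hits (U - {w})} = {a i, y}" using y(1) by blast
  then show ?thesis using block \<open>a i \<noteq> y\<close> i(1) by blast
qed

section \<open>Signs\<close>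

lemma rk_remove_less:
  assumes "U \<subseteq> X" "x \<in> U" "(x, y) \<in> r"
  shows "rk U y = Suc (rk (U - {x}) y)"
proof -
  have "{c \<in> U. (c, y) \<in> r} = insert x {c \<in> U - {x}. (c, y) \<in> r}" using assms by blast
  moreover have "finite {c \<in> U - {x}. (c, y) \<in> r}" using finite_if_subset_X[OF assms(1)] by simp
  ultimately show ?thesis by (simp add: rk_def)
qed

lemma rk_remove_not_less:
  assumes "(x, y) \<notin> r"
  shows "rk (U - {x}) y = rk U y"
proof -
  have "{c \<in> U - {x}. (c, y) \<in> r} = {c \<in> U. (c, y) \<in> r}" using assms by blast
  then show ?thesis by (simp add: rk_def)
qed

text \<open>The smaller of the two elements is counted in the rank of the larger one, but not
  conversely. Hence exactly one of the two deletions changes an exponent, and it does so by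
  one.\<close>

lemma sign_swap:
  assumes "U \<subseteq> X" "x \<in> U" "y \<in> U" "x \<noteq> y"
  shows "(- 1 :: 'r::comm_ring_1) ^ rk U x * (- 1) ^ rk (U - {x}) y
    = - ((- 1) ^ rk U y * (- 1) ^ rk (U - {y}) x)"
proof (cases "(x, y) \<in> r")
  case True
  then have "(y, x) \<notin> r" using assms r_total by blast
  then show ?thesis
    using rk_remove_less[OF assms(1,2) True] rk_remove_not_less[of y x U]
    by (simp add: mult.commute)
next
  case False
  then have "(y, x) \<in> r" using assms r_total by blast
  then show ?thesis
    using rk_remove_less[OF assms(1,3)] rk_remove_not_less[OF False, of U]
    by (simp add: mult.commute)
qed

text \<open>The elements \<open>x\<close> and \<open>y\<close> are neighbours in \<open>U\<close>:
  elements of other blocks compare with both in the same way by \<open>r_block\<close>. Their ranks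
  therefore differ by one.\<close>

lemma sign_edge:
  assumes U: "hits U" and i: "i \<in> {1..n}" and xy: "x \<noteq> y" "U \<inter> A i = {x, y}"
  shows "(- 1 :: 'r::comm_ring_1) ^ rk U x = - ((- 1) ^ rk U y)"
proof -
  have *: "rk U y = Suc (rk U x)" if "x \<noteq> y" "U \<inter> A i = {x, y}" "(x, y) \<in> r" for x y
  proof -
    have mem: "x \<in> X" "y \<in> X" "x \<in> U" "y \<in> U" "x \<in> A i" "y \<in> A i"
      using U that(2) by (auto simp: hits_def)
    have other: "(c, x) \<in> r \<longleftrightarrow> (c, y) \<in> r" if c: "c \<in> U" "c \<noteq> x" "c \<noteq> y" for c
    proof -
      obtain j where j: "j \<in> {1..n}" "c \<in> A j" using c U ex_block by blast
      then have "j \<noteq> i" using c \<open>U \<inter> A i = {x, y}\<close> by blast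
      then show ?thesis using r_block[OF i j(1) _ mem(5,6) j(2)] by simp
    qed
    have "(y, x) \<notin> r" using that r_total mem by blast
    then have "{c \<in> U. (c, y) \<in> r} = insert y {c \<in> U. (c, x) \<in> r}"
      using other that(3) r_refl mem by blast
    then show ?thesis
      using \<open>(y, x) \<notin> r\<close> finite_if_hits[OF U] by (simp add: rk_def)
  qed
  show ?thesis
  proof (cases "(x, y) \<in> r")
    case True then show ?thesis using *[OF xy] by simp
  next
    case False
    then have "(y, x) \<in> r" using r_total xy U by (auto simp: hits_def)
    then show ?thesis using *[of y x] xy by (simp add: insert_commute)
  qed
qed

section \<open>The boundary map and its coefficients\<close>

lemma bd_nonzero:
  assumes "bd U Q \<noteq> (0 :: ('a, 'k::field) mpoly)"
  shows "hits Q \<and> (\<exists>x\<in>X - Q. U = insert x Q)"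
proof (rule ccontr)
  assume "\<not> ?thesis"
  then have "bd U Q = (0 :: ('a, 'k) mpoly)"
    unfolding bd_def by (auto intro!: sum.neutral)
  then show False using assms by contradiction
qed

lemma bd_remove:
  assumes "U \<subseteq> X" "x \<in> U" "hits (U - {x})"
  shows "bd U (U - {x}) = ((- 1) ^ rk U x * var x :: ('a, 'k::field) mpoly)"
proof -
  have "bd U (U - {x}) = (\<Sum>y\<in>X - (U - {x}). if y = x then (- 1) ^ rk U x * var x else 0 :: ('a, 'k) mpoly)"
  proof -
    have "U = insert y (U - {x}) \<longleftrightarrow> y = x" if "y \<in> X - (U - {x})" for y
      using that assms(2) by blast
    then have "(\<Sum>y\<in>X - (U - {x}). if U = insert y (U - {x}) then (- 1) ^ rk U y * var y else 0)
        = (\<Sum>y\<in>X - (U - {x}). if y = x then (- 1) ^ rk U x * var x else 0 :: ('a, 'k) mpoly)"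
      by (intro sum.cong) simp_all
    then show ?thesis using assms(3) by (simp add: bd_def)
  qed
  also have "\<dots> = (- 1) ^ rk U x * var x" using assms finite_X by auto
  finally show ?thesis .
qed

lemma bd_hom: "bd U Q \<in> hom_polys X 1"
proof -
  have "(- 1) ^ k * var x \<in> hom_polys X 1" if "x \<in> X" for x k
  proof -
    have "var x \<in> hom_polys X 1" using that by (auto simp: hom_polys_def polys_def var_def)
    then show ?thesis by (cases "even k") (auto intro: hom_polys_uminus)
  qed
  then show ?thesis unfolding bd_def by (auto intro!: hom_polys_sum)
qed

lemma bd_free_module: "U \<in> faces (Suc p) \<Longrightarrow> bd U \<in> free_module (hom_polys X 1) (faces p)"
  unfolding free_module_def using bd_nonzero faces_remove bd_hom by blast

lemma lin_ext_bd:
  assumes v: "v \<in> free_module S (faces (Suc p))" and Q: "hits Q"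
  shows "lin_ext (faces (Suc p)) bd v Q
    = (\<Sum>x\<in>X - Q. (- 1) ^ rk (insert x Q) x * (v (insert x Q) * (var x :: ('a, 'k::field) mpoly)))"
proof -
  \<comment> \<open>Since \<open>v\<close> vanishes off the faces, the sum may run over all subsets
    of \<open>X\<close>. This makes the exchange of sums possible without asking whether
    \<open>insert x Q\<close> is a face.\<close>
  have "lin_ext (faces (Suc p)) bd v Q = (\<Sum>U\<in>Pow X. v U * bd U Q)"
    unfolding lin_ext_def
    by (rule sum.mono_neutral_left) (use v finite_X faces_subset_X in \<open>auto simp: free_module_def\<close>)
  also have "\<dots> = (\<Sum>U\<in>Pow X. \<Sum>x\<in>X - Q. if U = insert x Q then (- 1) ^ rk U x * (v U * var x) else 0)"
    using Q by (intro sum.cong) (auto simp: bd_def sum_distrib_left intro!: sum.cong)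
  also have "\<dots> = (\<Sum>x\<in>X - Q. \<Sum>U\<in>Pow X. if U = insert x Q then (- 1) ^ rk U x * (v U * var x) else 0)"
    by (rule sum.swap)
  also have "\<dots> = (\<Sum>x\<in>X - Q. (- 1) ^ rk (insert x Q) x * (v (insert x Q) * var x))"
  proof (rule sum.cong[OF refl])
    fix x assume "x \<in> X - Q"
    then have "insert x Q \<in> Pow X" using Q by (auto simp: hits_def)
    then show "(\<Sum>U\<in>Pow X. if U = insert x Q then (- 1) ^ rk U x * (v U * var x) else 0)
        = (- 1) ^ rk (insert x Q) x * (v (insert x Q) * var x)"
      using finite_X by simp
  qed
  finally show ?thesis .
qed

lemma lin_ext_bd_not_hits: "\<not> hits Q \<Longrightarrow> lin_ext B bd v Q = 0"
  by (simp add: lin_ext_def bd_def)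

text \<open>The simplicial argument: the coefficient at \<open>Q\<close> is a sum over ordered pairs
  of added vertices, antisymmetric by \<open>sign_swap\<close>. Both intermediate sets contain
  \<open>Q\<close> and so meet every block, hence the terms of each pair are present
  together.\<close>

lemma bd_bd:
  fixes v :: "'a set \<Rightarrow> ('a, 'k::field) mpoly"
  assumes v: "v \<in> free_module (polys X) (faces (Suc (Suc p)))"
  shows "lin_ext (faces (Suc p)) bd (lin_ext (faces (Suc (Suc p))) bd v) = (\<lambda>_. 0)"
proof
  fix Q
  let ?w = "lin_ext (faces (Suc (Suc p))) bd v"
  have w: "?w \<in> free_module (polys X) (faces (Suc p))"
    by (rule lin_ext_polys[OF free_module_hom_subset[OF bd_free_module] v])
  show "lin_ext (faces (Suc p)) bd ?w Q = 0"
  proof (cases "hits Q")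
    case True
    let ?f = "\<lambda>y x. (- 1) ^ rk (insert y Q) y * (- 1) ^ rk (insert x (insert y Q)) x *
        (v (insert x (insert y Q)) * (var x * var y))"
    have "lin_ext (faces (Suc p)) bd ?w Q = (\<Sum>y\<in>X - Q. (- 1) ^ rk (insert y Q) y * (?w (insert y Q) * var y))"
      by (rule lin_ext_bd[OF w True])
    also have "\<dots> = (\<Sum>y\<in>X - Q. \<Sum>x\<in>(X - Q) - {y}. ?f y x)"
    proof (rule sum.cong[OF refl])
      fix y assume "y \<in> X - Q"
      then have "hits (insert y Q)" using True hits_superset[OF True, of "insert y Q"]
        by (auto simp: hits_def)
      then have "?w (insert y Q) = (\<Sum>x\<in>X - insert y Q. (- 1) ^ rk (insert x (insert y Q)) x *
          (v (insert x (insert y Q)) * var x))"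
        by (rule lin_ext_bd[OF v])
      moreover have "X - insert y Q = (X - Q) - {y}" by blast
      ultimately show "(- 1) ^ rk (insert y Q) y * (?w (insert y Q) * var y) = (\<Sum>x\<in>(X - Q) - {y}. ?f y x)"
        by (simp add: sum_distrib_left sum_distrib_right mult_ac)
    qed
    also have "\<dots> = 0"
    proof (rule sum_antisymmetric[where r = r])
      show "finite (X - Q)" using finite_X by simp
      show "(x, y) \<in> r \<longleftrightarrow> (y, x) \<notin> r" if "x \<in> X - Q" "y \<in> X - Q" "x \<noteq> y" for x y
        using r_total that by blast
      show "?f x y = - ?f y x" if "x \<in> X - Q" "y \<in> X - Q" "x \<noteq> y" for x y
      proof -
        let ?M = "insert x (insert y Q)"
        have "?M - {x} = insert y Q" "?M - {y} = insert x Q" "?M \<subseteq> X"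
          using that True by (auto simp: hits_def)
        then have s: "(- 1 :: ('a, 'k) mpoly) ^ rk (insert x Q) x * (- 1) ^ rk ?M y
            = - ((- 1) ^ rk (insert y Q) y * (- 1) ^ rk ?M x)"
          using sign_swap[of ?M y x] that by (simp add: mult.commute)
        have M: "insert y (insert x Q) = ?M" by blast
        show ?thesis
          unfolding M s by (simp add: mult_ac)
      qed
    qed
    finally show ?thesis .
  qed (rule lin_ext_bd_not_hits)
qed

lemma var_mult_aug:
  "finite U \<Longrightarrow> x \<in> U \<Longrightarrow> var x * aug (U - {x}) = (aug U :: ('a, 'k::field) mpoly)"
  by (simp add: aug_def var_def mult_single set_monom_remove[of U x])

text \<open>An edge has exactly two facets meeting all blocks, obtained by removing one of the two
  elements of its double block. Both contribute the label of the edge, with opposite signs by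
  \<open>sign_edge\<close>.\<close>

lemma aug_bd:
  assumes U: "U \<in> faces 1"
  shows "(\<Sum>Q\<in>faces 0. bd U Q * aug Q) = (0 :: ('a, 'k::field) mpoly)"
proof -
  have h: "hits U" "card U = Suc n" "U \<subseteq> X" "finite U"
    using U faces_hits faces_card faces_subset_X finite_if_hits by auto
  then obtain i x y where i: "i \<in> {1..n}" and xy: "x \<noteq> y" "U \<inter> A i = {x, y}"
    and rem: "{w \<in> U. hits (U - {w})} = {x, y}"
    using edge_blocks by meson
  have hx: "x \<in> U" "hits (U - {x})" and hy: "y \<in> U" "hits (U - {y})" using rem by auto
  have sub: "{U - {x}, U - {y}} \<subseteq> faces 0"
    using U hx hy faces_remove[of x "U - {x}" 0] faces_remove[of y "U - {y}" 0]
    by (auto simp: insert_absorb)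
  have "(\<Sum>Q\<in>faces 0. bd U Q * aug Q) = (\<Sum>Q\<in>{U - {x}, U - {y}}. bd U Q * aug Q :: ('a, 'k) mpoly)"
  proof (rule sum.mono_neutral_right[OF finite_faces sub], rule ballI)
    fix Q assume Q: "Q \<in> faces 0 - {U - {x}, U - {y}}"
    have "bd U Q = (0 :: ('a, 'k) mpoly)"
    proof (rule ccontr)
      assume "bd U Q \<noteq> (0 :: ('a, 'k) mpoly)"
      then obtain w where w: "w \<in> X - Q" "U = insert w Q" "hits Q" using bd_nonzero by blast
      then have Uw: "U - {w} = Q" "w \<in> U" by auto
      then have "w \<in> {x, y}" using w(3) rem by blast
      then show False using Q Uw by auto
    qed
    then show "bd U Q * aug Q = (0 :: ('a, 'k) mpoly)" by simp
  qed
  also have "\<dots> = bd U (U - {x}) * aug (U - {x}) + bd U (U - {y}) * aug (U - {y})"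
    using hx hy xy(1) by (subst sum.insert) auto
  also have "\<dots> = (- 1) ^ rk U x * (var x * aug (U - {x})) + (- 1) ^ rk U y * (var y * aug (U - {y}))"
    by (simp add: bd_remove[OF h(3) hx] bd_remove[OF h(3) hy] mult.assoc)
  also have "\<dots> = ((- 1) ^ rk U x + (- 1) ^ rk U y) * aug U"
    using h(4) hx hy by (simp add: var_mult_aug distrib_right)
  also have "\<dots> = 0" by (simp add: sign_edge[OF h(1) i xy])
  finally show ?thesis .
qed


section \<open>Cycles with constant or linear coefficients\<close>

abbreviation face_cycles :: "nat \<Rightarrow> ('a set \<Rightarrow> ('a, 'k::field) mpoly) set" where
  "face_cycles \<equiv> cycles X faces aug (\<lambda>_. bd)"

lemma face_cycles_SucD:
  fixes v :: "'a set \<Rightarrow> ('a, 'k::field) mpoly"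
  assumes "v \<in> face_cycles (Suc p)" "hits Q"
  shows "(\<Sum>x\<in>X - Q. (- 1) ^ rk (insert x Q) x *
    Poly_Mapping.lookup (v (insert x Q) * var x) t) = 0"
proof -
  have "(\<Sum>x\<in>X - Q. (- 1) ^ rk (insert x Q) x * (v (insert x Q) * var x)) = 0"
    using assms(1) lin_ext_bd[OF _ assms(2), of v "polys X" p] by (simp add: cycles_def)
  then have "Poly_Mapping.lookup (\<Sum>x\<in>X - Q. (- 1) ^ rk (insert x Q) x * (v (insert x Q) * var x)) t = 0"
    by simp
  then show ?thesis by (simp only: lookup_sum lookup_minus_one_power_mult)
qed

lemma face_cycles_0D:
  fixes v :: "'a set \<Rightarrow> ('a, 'k::field) mpoly"
  assumes "v \<in> face_cycles 0"
  shows "(\<Sum>U\<in>faces 0. Poly_Mapping.lookup (v U * aug U) t) = 0"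
  using assms by (simp add: cycles_def flip: lookup_sum)

lemma lookup_mult_aug:
  "Poly_Mapping.lookup (f * aug U) (k + set_monom U) = Poly_Mapping.lookup f k"
  unfolding aug_def by (simp only: lookup_mult_single mult_1_right)

lemma lookup_mult_aug_eq_0:
  assumes "finite U" "x \<in> U" "Poly_Mapping.lookup t x = 0"
  shows "Poly_Mapping.lookup (f * aug U) t = 0"
  unfolding aug_def
proof (rule lookup_mult_single_eq_0)
  show "t \<noteq> k + set_monom U" for k
    using assms by (auto simp: lookup_add lookup_set_monom)
qed

text \<open>Distinct vertices have distinct labels, which settles degree 0. In higher degree choose
  a removable \<open>x\<close> in \<open>U\<close>: in the boundary at \<open>U - {x}\<close>, the
  variable \<open>x\<close> arises only from \<open>U\<close>, so the coefficient of
  \<open>U\<close> is zero.\<close>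

lemma const_cycle_zero:
  fixes v :: "'a set \<Rightarrow> ('a, 'k::field) mpoly"
  assumes v: "v \<in> face_cycles p" "v \<in> free_module (hom_polys X 0) (faces p)"
  shows "v = (\<lambda>_. 0)"
proof
  fix U
  show "v U = 0"
  proof (cases "U \<in> faces p")
    case False
    then show ?thesis using v(2) by (simp add: free_module_def)
  next
    case U: True
    have "Poly_Mapping.lookup (v U) 0 = 0"
    proof (cases p)
      case 0
      have "Poly_Mapping.lookup (v V * aug V) (set_monom U) = (if V = U then Poly_Mapping.lookup (v U) 0 else 0)"
        if V: "V \<in> faces 0" for V
      proof (cases "V = U")
        case True
        then show ?thesis using lookup_mult_aug[of "v U" U 0] by simp
      next
        case False
        have "card V = card U" using V U 0 faces_card by metis
        then obtain x where "x \<in> V" "x \<notin> U"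
          using False card_subset_eq[OF finite_if_hits[OF faces_hits[OF U]]] by blast
        then show ?thesis
          using False lookup_mult_aug_eq_0[of V x "set_monom U"] finite_if_hits[OF faces_hits[OF V]]
            finite_if_hits[OF faces_hits[OF U]]
          by (simp add: lookup_set_monom)
      qed
      then have "(\<Sum>V\<in>faces 0. if V = U then Poly_Mapping.lookup (v U) 0 else 0) = 0"
        using face_cycles_0D[of v "set_monom U"] v(1) 0 by simp
      then show ?thesis using U 0 finite_faces by simp
    next
      case (Suc q)
      have hU: "hits U" "U \<subseteq> X" using U faces_hits faces_subset_X by auto
      obtain a where "transversal a U" using ex_transversal[OF hU(1)] by blast
      then obtain x where x: "x \<in> U" "hits (U - {x})"
        using ex_removable[OF hU(1)] faces_card[OF U] Suc by auto
      have "(\<Sum>y\<in>X - (U - {x}). (- 1) ^ rk (insert y (U - {x})) y *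
          Poly_Mapping.lookup (v (insert y (U - {x})) * var y) (Poly_Mapping.single x 1)) = 0"
        using face_cycles_SucD v(1) x(2) Suc by blast
      moreover have "(- 1) ^ rk (insert y (U - {x})) y *
          Poly_Mapping.lookup (v (insert y (U - {x})) * var y) (Poly_Mapping.single x 1)
          = (if y = x then (- 1) ^ rk U x * Poly_Mapping.lookup (v U) 0 else 0)" for y
        using x(1) by (simp add: lookup_mult_var_single insert_absorb del: One_nat_def)
      ultimately have "(\<Sum>y\<in>X - (U - {x}). if y = x then (- 1) ^ rk U x * Poly_Mapping.lookup (v U) 0 else 0) = 0"
        by simp
      moreover have "x \<in> X - (U - {x})" using x hU by blast
      ultimately show ?thesis using finite_X by simp
    qed
    moreover have "v U \<in> hom_polys X 0" using v(2) U by (simp add: free_module_def)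
    ultimately show ?thesis using hom_polys_0D by fastforce
  qed
qed

text \<open>Coefficients of a cycle with linear entries in the squarefree multidegree \<open>M\<close>. With the
  sign they turn out not to depend on \<open>x\<close>, so that either they all vanish or every facet
  of \<open>M\<close> is a cell, which makes \<open>M\<close> a cell.\<close>

definition lin_coeff :: "('a set \<Rightarrow> ('a, 'k::field) mpoly) \<Rightarrow> 'a set \<Rightarrow> 'a \<Rightarrow> 'k" where
  "lin_coeff z M x = (- 1) ^ rk M x * Poly_Mapping.lookup (z (M - {x})) (Poly_Mapping.single x 1)"

text \<open>In positive degree remove some \<open>x\<close> other than \<open>y\<close>. At
  \<open>R - {x}\<close>, the multidegree \<open>x y\<close> is reached only by adding
  \<open>x\<close>, because \<open>y\<close> is already present. In degree 0, any other vertex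
  contains an element that does not divide \<open>y\<close> times the label of
  \<open>R\<close>.\<close>

lemma linear_cycle_squarefree:
  fixes z :: "'a set \<Rightarrow> ('a, 'k::field) mpoly"
  assumes z: "z \<in> face_cycles p" and R: "R \<in> faces p" "y \<in> R"
  shows "Poly_Mapping.lookup (z R) (Poly_Mapping.single y 1) = 0"
proof -
  have hR: "hits R" "R \<subseteq> X" "finite R" using R faces_hits faces_subset_X finite_if_hits by auto
  show ?thesis
  proof (cases p)
    case 0
    let ?t = "Poly_Mapping.single y 1 + set_monom R"
    have "Poly_Mapping.lookup (z V * aug V) ?t
        = (if V = R then Poly_Mapping.lookup (z R) (Poly_Mapping.single y 1) else 0)"
      if V: "V \<in> faces 0" for V
    proof (cases "V = R")
      case True
      then show ?thesis using lookup_mult_aug[of "z R" R "Poly_Mapping.single y 1"] by simp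
    next
      case False
      have "card V = card R" using V R 0 faces_card by metis
      then obtain x where x: "x \<in> V" "x \<notin> R"
        using False card_subset_eq[OF hR(3)] by blast
      then have "Poly_Mapping.lookup ?t x = 0"
        using R(2) hR(3) by (auto simp: lookup_set_monom lookup_add lookup_single when_def)
      then show ?thesis
        using False lookup_mult_aug_eq_0[OF _ x(1)] finite_if_hits[OF faces_hits[OF V]] by simp
    qed
    then have "(\<Sum>V\<in>faces 0. if V = R then Poly_Mapping.lookup (z R) (Poly_Mapping.single y 1) else 0) = 0"
      using face_cycles_0D[of z ?t] z 0 by simp
    then show ?thesis using R 0 finite_faces by simp
  next
    case (Suc q)
    \<comment> \<open>The transversal passes through \<open>y\<close> to guarantee that the
      removable vertex \<open>x\<close> is not \<open>y\<close>.\<close>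
    obtain a where a: "transversal a R" "y \<in> a ` {1..n}"
      using ex_transversal_through[OF hR(1) R(2)] by blast
    then obtain x where x: "x \<in> R" "x \<notin> a ` {1..n}" "hits (R - {x})"
      using ex_removable[OF hR(1)] faces_card[OF R(1)] Suc by auto
    have xy: "x \<noteq> y" using a(2) x(2) by blast
    let ?Q = "R - {x}"
    have "(\<Sum>b\<in>X - ?Q. (- 1) ^ rk (insert b ?Q) b *
        Poly_Mapping.lookup (z (insert b ?Q) * var b) (Poly_Mapping.single x 1 + Poly_Mapping.single y 1)) = 0"
      using face_cycles_SucD z x(3) Suc by blast
    moreover have "(- 1) ^ rk (insert b ?Q) b *
        Poly_Mapping.lookup (z (insert b ?Q) * var b) (Poly_Mapping.single x 1 + Poly_Mapping.single y 1)
        = (if b = x then (- 1) ^ rk R x * Poly_Mapping.lookup (z R) (Poly_Mapping.single y 1) else 0)"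
      if "b \<in> X - ?Q" for b
    proof (cases "b = x")
      case True
      then show ?thesis
        using x(1) by (simp add: lookup_mult_var_pair[OF xy] insert_absorb del: One_nat_def)
    next
      case False
      then have "b \<noteq> y" using that R(2) xy by blast
      then show ?thesis
        using False by (simp add: lookup_mult_var_pair[OF xy] del: One_nat_def)
    qed
    ultimately have "(\<Sum>b\<in>X - ?Q. if b = x then (- 1) ^ rk R x * Poly_Mapping.lookup (z R) (Poly_Mapping.single y 1) else 0) = 0"
      by simp
    moreover have "x \<in> X - ?Q" using x hR by blast
    ultimately show ?thesis using finite_X by simp
  qed
qed

text \<open>At \<open>M - {x, y}\<close>, the multidegree \<open>x y\<close> of the boundary has two
  contributions, from \<open>M - {y}\<close> and from \<open>M - {x}\<close>. They cancel, and
  \<open>sign_swap\<close> turns the cancellation into equality of the signed coefficients.\<close>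

lemma lin_coeff_link:
  fixes z :: "'a set \<Rightarrow> ('a, 'k::field) mpoly"
  assumes z: "z \<in> face_cycles (Suc q)"
    and M: "M \<subseteq> X" "x \<in> M" "y \<in> M" "x \<noteq> y" "hits (M - {x, y})"
  shows "lin_coeff z M x = lin_coeff z M y"
proof -
  let ?Q = "M - {x, y}"
  let ?zx = "Poly_Mapping.lookup (z (M - {x})) (Poly_Mapping.single x 1)"
  let ?zy = "Poly_Mapping.lookup (z (M - {y})) (Poly_Mapping.single y 1)"
  let ?a = "(- 1 :: 'k) ^ rk M x" and ?b = "(- 1 :: 'k) ^ rk M y"
  let ?c = "(- 1 :: 'k) ^ rk (M - {x}) y" and ?d = "(- 1 :: 'k) ^ rk (M - {y}) x"
  have ins: "insert x ?Q = M - {y}" "insert y ?Q = M - {x}" using M by auto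
  have "(\<Sum>b\<in>X - ?Q. (- 1) ^ rk (insert b ?Q) b *
      Poly_Mapping.lookup (z (insert b ?Q) * var b) (Poly_Mapping.single x 1 + Poly_Mapping.single y 1)) = 0"
    by (rule face_cycles_SucD[OF z M(5)])
  moreover have "(- 1) ^ rk (insert b ?Q) b *
      Poly_Mapping.lookup (z (insert b ?Q) * var b) (Poly_Mapping.single x 1 + Poly_Mapping.single y 1)
      = (if b = x then ?d * ?zy else 0) + (if b = y then ?c * ?zx else 0)" for b
    using M(4) ins by (simp add: lookup_mult_var_pair[OF M(4)] del: One_nat_def)
  ultimately have "(\<Sum>b\<in>X - ?Q. (if b = x then ?d * ?zy else 0) + (if b = y then ?c * ?zx else 0)) = 0"
    by simp
  moreover have "x \<in> X - ?Q" "y \<in> X - ?Q" using M by auto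
  ultimately have eq: "?d * ?zy + ?c * ?zx = 0"
    using finite_X by (simp add: sum.distrib)
  have s: "?a * ?c = - (?b * ?d)" by (rule sign_swap[OF M(1-4)])
  \<comment> \<open>Signs are their own inverses, so multiplying by \<open>?c\<close> or
    \<open>?d\<close> moves a sign across the relation.\<close>
  have sq: "?c * ?c = 1" "?d * ?d = 1" by (simp_all flip: power_add power_mult_distrib)
  have "?a * ?zx = (?a * ?c) * (?c * ?zx)" using sq(1) by (simp add: algebra_simps)
  also have "\<dots> = (?b * ?d) * (?d * ?zy)"
    using eq unfolding s by (simp add: add_eq_0_iff2)
  also have "\<dots> = ?b * ?zy" using sq(2) by (simp add: algebra_simps)
  finally show ?thesis by (simp add: lin_coeff_def)
qed

text \<open>In degree 0 the relation comes from the augmentation in the multidegree of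
  \<open>M\<close>. Only the vertices \<open>M - {x}\<close> and \<open>M - {y}\<close> reach it,
  and their signs in \<open>M\<close> are opposite by \<open>sign_edge\<close>.\<close>

lemma lin_coeff_edge:
  fixes z :: "'a set \<Rightarrow> ('a, 'k::field) mpoly"
  assumes z: "z \<in> face_cycles 0" and M: "hits M" "card M = Suc n"
    and x: "x \<in> M" "hits (M - {x})" and y: "y \<in> M" "hits (M - {y})"
  shows "lin_coeff z M x = lin_coeff z M y"
proof (cases "x = y")
  case False
  have fM: "finite M" "M \<subseteq> X" using M finite_if_hits hits_def by auto
  obtain i x' y' where i: "i \<in> {1..n}" "x' \<noteq> y'" "M \<inter> A i = {x', y'}" "{w \<in> M. hits (M - {w})} = {x', y'}"
    using edge_blocks[OF M] by meson
  have "x \<in> {x', y'}" "y \<in> {x', y'}" using i(4) x y by blast+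
  then have xy': "{x, y} = {x', y'}" using False by auto
  let ?l = "\<lambda>x. Poly_Mapping.lookup (z (M - {x})) (Poly_Mapping.single x 1)"
  have *: "Poly_Mapping.lookup (z V * aug V) (set_monom M)
      = (if V = M - {x} then ?l x else 0) + (if V = M - {y} then ?l y else 0)"
    if V: "V \<in> faces 0" for V
  proof -
    have fV: "finite V" "card V = n" "hits V"
      using V faces_hits faces_card[OF V] finite_if_hits by auto
    show ?thesis
    proof (cases "V \<subseteq> M")
      case True
      then have "card (M - V) = 1" using M(2) fV fM card_Diff_subset[of V M] by simp
      then obtain w where "M - V = {w}" by (auto simp: card_1_singleton_iff)
      then have w: "w \<in> M" "V = M - {w}" using True by auto
      have "w \<in> {x, y}" using w fV(3) i(4) xy' by blast
      moreover have "M - {x} \<noteq> M - {y}" using False x y by blast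
      moreover have "Poly_Mapping.lookup (z (M - {w}) * aug (M - {w})) (set_monom M) = ?l w"
        unfolding set_monom_remove[OF fM(1) w(1)] by (rule lookup_mult_aug)
      ultimately show ?thesis unfolding w(2) by auto
    next
      case nsub: False
      then obtain w where "w \<in> V" "w \<notin> M" by blast
      then have "Poly_Mapping.lookup (z V * aug V) (set_monom M) = 0"
        by (intro lookup_mult_aug_eq_0[OF fV(1)]) (auto simp: lookup_set_monom fM)
      moreover have "V \<noteq> M - {x}" "V \<noteq> M - {y}" using nsub by auto
      ultimately show ?thesis by simp
    qed
  qed
  \<comment> \<open>The sets obtained from \<open>M\<close> need not be cells. There
    \<open>z\<close> is zero, so the relation below also holds when one or both of the terms are
    absent.\<close>
  have off: "?l w = 0" if "M - {w} \<notin> faces 0" for w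
    using z that by (simp add: cycles_def free_module_def)
  have "(\<Sum>V\<in>faces 0. (if V = M - {x} then ?l x else 0) + (if V = M - {y} then ?l y else 0)) = 0"
    using face_cycles_0D[OF z, of "set_monom M"] * by simp
  then have eq: "?l x + ?l y = 0"
    using off[of x] off[of y] by (simp add: sum.distrib finite_faces split: if_splits)
  have "M \<inter> A i = {x, y}" using i(3) xy' by simp
  then have s: "(- 1 :: 'k) ^ rk M x = - ((- 1) ^ rk M y)" by (rule sign_edge[OF M(1) i(1) False])
  have "?l x = - ?l y" using eq by (rule eq_neg_iff_add_eq_0[THEN iffD2])
  then show ?thesis unfolding lin_coeff_def s by simp
qed simp

text \<open>If \<open>M - {x, y}\<close> misses a block, then \<open>x\<close> and \<open>y\<close>
  are the only elements of that block in \<open>M\<close>, and there is no direct relation between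
  them. A third vertex \<open>w\<close> is then linked to both.\<close>

lemma lin_coeff_eq:
  fixes z :: "'a set \<Rightarrow> ('a, 'k::field) mpoly"
  assumes z: "z \<in> face_cycles p" and M: "hits M" "card M = n + Suc p"
    and x: "x \<in> M" "hits (M - {x})" and y: "y \<in> M" "hits (M - {y})"
  shows "lin_coeff z M x = lin_coeff z M y"
proof (cases "x = y")
  case neq: False
  have fM: "finite M" "M \<subseteq> X" using M finite_if_hits hits_def by auto
  show ?thesis
  proof (cases p)
    case 0
    then show ?thesis using lin_coeff_edge[OF _ M(1) _ x y] z M(2) by simp
  next
    case (Suc q)
    note link = lin_coeff_link[OF z[unfolded Suc] fM(2)]
    show ?thesis
    proof (cases "hits (M - {x, y})")
      case True
      then show ?thesis using link x(1) y(1) neq by blast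
    next
      case False
      then obtain i where i: "i \<in> {1..n}" "(M - {x, y}) \<inter> A i = {}"
        using fM by (auto simp: hits_def)
      have xi: "x \<in> A i" using y(2) i by (auto simp: hits_def)
      have yi: "y \<in> A i" using x(2) i by (auto simp: hits_def)
      obtain a where a: "transversal a M" "x \<in> a ` {1..n}"
        using ex_transversal_through[OF M(1) x(1)] by blast
      have aA: "a j \<in> A j" if "j \<in> {1..n}" for j using a(1) that by (simp add: transversal_def)
      have "x = a i" using a(2) aA same_block[OF i(1) _ xi] by blast
      \<comment> \<open>In positive degree \<open>M\<close> has at least \<open>n + 2\<close>
        elements, while the transversal together with \<open>y\<close> has at most
        \<open>n + 1\<close>. This leaves room for \<open>w\<close>.\<close>
      have "card (insert y (a ` {1..n})) < card M"
        using transversal_card[OF a(1)] M(2) Suc card_insert_if[of "a ` {1..n}" y] by (simp split: if_splits)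
      then have "\<not> M \<subseteq> insert y (a ` {1..n})"
        using card_mono[of "insert y (a ` {1..n})" M] by auto
      then obtain w where w: "w \<in> M" "w \<noteq> y" "w \<notin> a ` {1..n}" by blast
      have wx: "w \<noteq> x" using a(2) w(3) by blast
      \<comment> \<open>In the common block \<open>a\<close> chooses \<open>x\<close>, so it avoids
        \<open>w\<close> and \<open>y\<close>. Exchanging \<open>x\<close> for \<open>y\<close>
        gives a transversal avoiding \<open>w\<close> and \<open>x\<close>.\<close>
      have "y \<notin> a ` {1..n}"
        using aA same_block[OF i(1) _ yi] neq \<open>x = a i\<close> by blast
      then have "hits (M - {w, y})"
        using a(1) w fM by (intro transversal_hits[OF a(1)]) (auto simp: transversal_def)
      moreover have "hits (M - {w, x})"
      proof (rule transversal_hits)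
        show "transversal (a(i := y)) M" using a(1) i(1) yi y(1) by (auto simp: transversal_def)
        show "(a(i := y)) ` {1..n} \<subseteq> M - {w, x}"
        proof
          fix u assume "u \<in> (a(i := y)) ` {1..n}"
          then obtain j where j: "j \<in> {1..n}" "u = (a(i := y)) j" by blast
          show "u \<in> M - {w, x}"
          proof (cases "j = i")
            case True then show ?thesis using j y(1) w(2) neq by auto
          next
            case False
            then have "a j \<noteq> x" using same_block[OF j(1) i(1) aA[OF j(1)]] xi by auto
            then show ?thesis using j False a(1) w(3) by (auto simp: transversal_def)
          qed
        qed
        show "M - {w, x} \<subseteq> X" using fM by blast
      qed
      ultimately show ?thesis
        using link[OF w(1) x(1) wx] link[OF w(1) y(1) w(2)] by simp
    qed
  qed
qed simp

text \<open>The preimage assigns to each cell \<open>M\<close> the common value of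
  \<open>lin_coeff z M\<close>. The coefficient of a variable \<open>y\<close> at \<open>R\<close>
  is settled by \<open>linear_cycle_squarefree\<close> if \<open>y\<close> lies in \<open>R\<close>;
  otherwise it arises from \<open>insert y R\<close> alone.\<close>

lemma linear_cycle_boundary:
  fixes z :: "'a set \<Rightarrow> ('a, 'k::field) mpoly"
  assumes z: "z \<in> face_cycles p" "z \<in> free_module (hom_polys X 1) (faces p)"
  shows "\<exists>c \<in> free_module (hom_polys X 0) (faces (Suc p)). lin_ext (faces (Suc p)) bd c = z"
proof -
  \<comment> \<open>By \<open>lin_coeff_eq\<close> every removable vertex gives the same value, so
    the choice made by \<open>SOME\<close> is immaterial.\<close>
  define c :: "'a set \<Rightarrow> ('a, 'k) mpoly" where "c M = (if M \<in> faces (Suc p)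
      then Poly_Mapping.single 0 (lin_coeff z M (SOME x. x \<in> M \<and> hits (M - {x}))) else 0)" for M
  have c: "c \<in> free_module (hom_polys X 0) (faces (Suc p))"
    by (simp add: free_module_def c_def)
  have c_eq: "Poly_Mapping.lookup (c M) 0 = lin_coeff z M x"
    if M: "hits M" "card M = n + Suc p" and x: "x \<in> M" "hits (M - {x})" for M x
  proof (cases "M \<in> faces (Suc p)")
    case True
    let ?y = "SOME x. x \<in> M \<and> hits (M - {x})"
    have "?y \<in> M \<and> hits (M - {?y})" by (rule someI) (use x in blast)
    then show ?thesis
      using lin_coeff_eq[OF z(1) M _ _ x, of ?y] True by (simp add: c_def)
  next
    case False
    \<comment> \<open>On a facet that is no cell \<open>z\<close> is zero, so the common value for
      \<open>M\<close> is zero too, in agreement with the default in \<open>c\<close>.\<close>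
    then obtain w where w: "w \<in> M" "hits (M - {w})" "M - {w} \<notin> faces p"
      using faces_if_all_facets[OF M] by blast
    then have "lin_coeff z M w = 0" using z(2) by (simp add: lin_coeff_def free_module_def)
    then show ?thesis
      using lin_coeff_eq[OF z(1) M w(1,2) x] False by (simp add: c_def)
  qed
  have dc: "lin_ext (faces (Suc p)) bd c \<in> free_module (hom_polys X 1) (faces p)"
    using lin_ext_hom[OF bd_free_module c] by simp
  have "lin_ext (faces (Suc p)) bd c R = z R" for R
  proof (cases "R \<in> faces p")
    case False
    then show ?thesis using dc z(2) by (simp add: free_module_def)
  next
    case R: True
    then have hR: "hits R" "R \<subseteq> X" "card R = n + p" "finite R"
      using faces_hits faces_subset_X faces_card finite_if_hits by auto
    let ?u = "lin_ext (faces (Suc p)) bd c R"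
    have hom: "?u \<in> hom_polys X 1" "z R \<in> hom_polys X 1"
      using dc z(2) R by (auto simp: free_module_def)
    have coeff: "Poly_Mapping.lookup ?u (Poly_Mapping.single y 1) = Poly_Mapping.lookup (z R) (Poly_Mapping.single y 1)"
      if "y \<in> X" for y
    proof -
      have "Poly_Mapping.lookup ?u (Poly_Mapping.single y 1) = (\<Sum>x\<in>X - R. (- 1) ^ rk (insert x R) x *
          Poly_Mapping.lookup (c (insert x R) * var x) (Poly_Mapping.single y 1))"
        by (simp only: lin_ext_bd[OF c hR(1)] lookup_sum lookup_minus_one_power_mult)
      also have "\<dots> = (\<Sum>x\<in>X - R. if x = y then (- 1) ^ rk (insert y R) y * Poly_Mapping.lookup (c (insert y R)) 0 else 0)"
        by (rule sum.cong) (auto simp: lookup_mult_var_single simp del: One_nat_def)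
      also have "\<dots> = (if y \<in> R then 0 else (- 1) ^ rk (insert y R) y * Poly_Mapping.lookup (c (insert y R)) 0)"
        using finite_X that by simp
      also have "\<dots> = Poly_Mapping.lookup (z R) (Poly_Mapping.single y 1)"
      proof (cases "y \<in> R")
        case True
        then show ?thesis using linear_cycle_squarefree[OF z(1) R] by simp
      next
        case False
        \<comment> \<open>Removing \<open>y\<close> from \<open>insert y R\<close> gives back
          \<open>R\<close>. The sign inside \<open>lin_coeff\<close> then cancels the sign in the
          boundary.\<close>
        have "Poly_Mapping.lookup (c (insert y R)) 0 = lin_coeff z (insert y R) y"
          using hits_superset[OF hR(1), of "insert y R"] hR that False by (intro c_eq) auto
        then show ?thesis using False
          by (simp add: lin_coeff_def mult.assoc[symmetric] flip: power_mult_distrib)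
      qed
      finally show ?thesis .
    qed
    show ?thesis
    proof (rule poly_mapping_eqI)
      fix m
      show "Poly_Mapping.lookup ?u m = Poly_Mapping.lookup (z R) m"
      proof (cases "m \<in> Poly_Mapping.keys ?u \<or> m \<in> Poly_Mapping.keys (z R)")
        case True
        then have "total_degree m = 1" "Poly_Mapping.keys m \<subseteq> X"
          using hom by (auto simp: hom_polys_def polys_def)
        then show ?thesis using total_degree_eq_1[of m] coeff by auto
      qed (simp add: in_keys_iff)
    qed
  qed
  then show ?thesis using c by blast
qed

lemma bd_cycle:
  assumes "U \<in> faces (Suc p)"
  shows "(bd U :: 'a set \<Rightarrow> ('a, 'k::field) mpoly) \<in> face_cycles p"
proof -
  have mem: "(bd U :: 'a set \<Rightarrow> ('a, 'k) mpoly) \<in> free_module (polys X) (faces p)"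
    by (rule free_module_hom_subset[OF bd_free_module[OF assms]])
  show ?thesis
  proof (cases p)
    case 0
    then show ?thesis using mem aug_bd assms by (simp add: cycles_def)
  next
    case (Suc q)
    have "(basis_vec U :: 'a set \<Rightarrow> ('a, 'k) mpoly) \<in> free_module (polys X) (faces (Suc (Suc q)))"
      using assms Suc by (intro free_module_hom_subset[OF basis_vec_free_module_hom]) simp
    from bd_bd[OF this] have "lin_ext (faces p) bd (bd U :: 'a set \<Rightarrow> ('a, 'k) mpoly) = (\<lambda>_. 0)"
      using assms Suc by (simp add: lin_ext_basis_vec finite_faces)
    then show ?thesis using mem Suc by (simp add: cycles_def)
  qed
qed

lemma linear_complex_faces:
  "linear_complex n X faces (aug :: 'a set \<Rightarrow> ('a, 'k::field) mpoly) (\<lambda>_. bd)"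
proof
  show "(aug U :: ('a, 'k) mpoly) \<in> hom_polys X n" if "U \<in> faces 0" for U
    using faces_subset_X[OF that] faces_card[OF that] finite_if_subset_X[of U]
    by (simp add: aug_def hom_polys_def polys_def keys_set_monom total_degree_set_monom)
qed (simp_all add: finite_faces bd_free_module[unfolded One_nat_def] bd_cycle linear_cycle_boundary)

end

section \<open>Change of bases\<close>

text \<open>Transport of a complex along bijections of bases. It is used between cells and subsets
  of \<open>X\<close>, and again to number the subsets, since linear resolutions are stated over
  bases of natural numbers. Entries off the bases are required to vanish because vectors are
  functions on a whole type.\<close>

locale relabelling =
  fixes X :: "'a set" and B :: "nat \<Rightarrow> 'b set" and \<epsilon> :: "'b \<Rightarrow> ('a, 'k::field) mpoly"
    and d :: "nat \<Rightarrow> 'b \<Rightarrow> 'b \<Rightarrow> ('a, 'k) mpoly"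
    and B' :: "nat \<Rightarrow> 'c set" and \<epsilon>' :: "'c \<Rightarrow> ('a, 'k) mpoly"
    and d' :: "nat \<Rightarrow> 'c \<Rightarrow> 'c \<Rightarrow> ('a, 'k) mpoly" and g :: "'b \<Rightarrow> 'c"
  assumes bij: "bij_betw g (B p) (B' p)"
    and aug_relabel: "b \<in> B 0 \<Longrightarrow> \<epsilon>' (g b) = \<epsilon> b"
    and diff_relabel: "b \<in> B (Suc p) \<Longrightarrow> c \<in> B p \<Longrightarrow> d' (Suc p) (g b) (g c) = d (Suc p) b c"
    and diff_outside: "b \<in> B (Suc p) \<Longrightarrow> c \<notin> B p \<Longrightarrow> d (Suc p) b c = 0"
    and diff_outside': "b' \<in> B' (Suc p) \<Longrightarrow> c' \<notin> B' p \<Longrightarrow> d' (Suc p) b' c' = 0"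
begin

definition pull :: "nat \<Rightarrow> ('c \<Rightarrow> ('a, 'k) mpoly) \<Rightarrow> 'b \<Rightarrow> ('a, 'k) mpoly" where
  "pull p w b = (if b \<in> B p then w (g b) else 0)"

lemma pull_zero [simp]: "pull p (\<lambda>_. 0) = (\<lambda>_. 0)"
  by (simp add: pull_def fun_eq_iff)

lemma relabel_mem: "b \<in> B p \<Longrightarrow> g b \<in> B' p"
  using bij bij_betwE by blast

lemma ex_relabel: "c \<in> B' p \<Longrightarrow> \<exists>b\<in>B p. c = g b"
  using bij[of p] by (auto simp: bij_betw_def)

text \<open>The coefficient set \<open>S\<close> is kept arbitrary, so that minimality is covered by
  taking the ideal of the variables.\<close>

lemma pull_free_module:
  assumes "\<And>c. c \<notin> B' p \<Longrightarrow> w c = 0"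
  shows "pull p w \<in> free_module S (B p) \<longleftrightarrow> w \<in> free_module S (B' p)"
  using assms relabel_mem ex_relabel unfolding free_module_def pull_def by fastforce

lemma pull_inject:
  assumes "pull p w = pull p w'" "\<And>c. c \<notin> B' p \<Longrightarrow> w c = 0" "\<And>c. c \<notin> B' p \<Longrightarrow> w' c = 0"
  shows "w = w'"
proof
  fix c
  show "w c = w' c"
  proof (cases "c \<in> B' p")
    case True
    then obtain b where "b \<in> B p" "c = g b" using ex_relabel by blast
    then show ?thesis using fun_cong[OF assms(1), of b] by (simp add: pull_def)
  qed (simp add: assms(2,3))
qed

lemma ex_pull:
  assumes "v \<in> free_module S (B p)"
  shows "\<exists>w\<in>free_module S (B' p). pull p w = v"
proof -
  define w where "w c = (if c \<in> B' p then v (inv_into (B p) g c) else 0)" for c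
  have "pull p w b = v b" for b
  proof (cases "b \<in> B p")
    case True
    then show ?thesis
      using relabel_mem[OF True] bij_betw_imp_inj_on[OF bij] by (simp add: pull_def w_def)
  next
    case False
    then show ?thesis using assms by (simp add: pull_def free_module_def)
  qed
  then have "pull p w = v" by blast
  moreover have "w \<in> free_module S (B' p)"
    using pull_free_module[of p w S] assms \<open>pull p w = v\<close> by (simp add: w_def)
  ultimately show ?thesis by blast
qed

lemma sum_pull: "(\<Sum>c\<in>B' p. w c * e c) = (\<Sum>b\<in>B p. pull p w b * e (g b))"
  by (subst sum.reindex_bij_betw[OF bij, symmetric]) (simp add: pull_def)

lemma lin_ext_outside': "c \<notin> B' p \<Longrightarrow> lin_ext (B' (Suc p)) (d' (Suc p)) w c = 0"
  by (simp add: lin_ext_def diff_outside')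

lemma pull_lin_ext:
  "pull p (lin_ext (B' (Suc p)) (d' (Suc p)) w) = lin_ext (B (Suc p)) (d (Suc p)) (pull (Suc p) w)"
proof
  fix c
  show "pull p (lin_ext (B' (Suc p)) (d' (Suc p)) w) c = lin_ext (B (Suc p)) (d (Suc p)) (pull (Suc p) w) c"
  proof (cases "c \<in> B p")
    case True
    then show ?thesis
      by (simp add: pull_def[of p] lin_ext_def sum_pull diff_relabel cong: sum.cong)
  qed (simp add: pull_def[of p] lin_ext_def diff_outside)
qed

text \<open>Pulling back forgets the values outside \<open>B' p\<close>, hence the extra condition
  that \<open>w\<close> vanishes there.\<close>

lemma boundaries_relabel:
  "w \<in> lin_ext (B' (Suc p)) (d' (Suc p)) ` free_module S (B' (Suc p)) \<longleftrightarrow>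
   (\<forall>c. c \<notin> B' p \<longrightarrow> w c = 0) \<and> pull p w \<in> lin_ext (B (Suc p)) (d (Suc p)) ` free_module S (B (Suc p))"
  (is "?L \<longleftrightarrow> ?R")
proof
  assume ?L
  then obtain y where y: "y \<in> free_module S (B' (Suc p))" "w = lin_ext (B' (Suc p)) (d' (Suc p)) y"
    by blast
  moreover have "pull (Suc p) y \<in> free_module S (B (Suc p))"
    using y(1) pull_free_module[of "Suc p" y S] by (auto simp: free_module_def)
  ultimately show ?R using lin_ext_outside' pull_lin_ext by blast
next
  assume R: ?R
  then obtain y where y: "y \<in> free_module S (B (Suc p))" "pull p w = lin_ext (B (Suc p)) (d (Suc p)) y"
    by blast
  then obtain u where u: "u \<in> free_module S (B' (Suc p))" "pull (Suc p) u = y"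
    using ex_pull by blast
  have "w = lin_ext (B' (Suc p)) (d' (Suc p)) u"
    by (rule pull_inject[of p]) (use R y u pull_lin_ext lin_ext_outside' in auto)
  then show ?L using u(1) by blast
qed

lemma cycles_relabel:
  "w \<in> cycles X B' \<epsilon>' d' p \<longleftrightarrow> (\<forall>c. c \<notin> B' p \<longrightarrow> w c = 0) \<and> pull p w \<in> cycles X B \<epsilon> d p"
proof -
  have sum: "(\<Sum>c\<in>B' 0. w c * \<epsilon>' c) = (\<Sum>b\<in>B 0. pull 0 w b * \<epsilon> b)"
    by (simp add: sum_pull aug_relabel cong: sum.cong)
  have diff: "lin_ext (B' (Suc q)) (d' (Suc q)) w = (\<lambda>_. 0) \<longleftrightarrow>
      lin_ext (B (Suc q)) (d (Suc q)) (pull (Suc q) w) = (\<lambda>_. 0)" for q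
  proof
    assume "lin_ext (B' (Suc q)) (d' (Suc q)) w = (\<lambda>_. 0)"
    then show "lin_ext (B (Suc q)) (d (Suc q)) (pull (Suc q) w) = (\<lambda>_. 0)"
      by (simp flip: pull_lin_ext)
  next
    assume "lin_ext (B (Suc q)) (d (Suc q)) (pull (Suc q) w) = (\<lambda>_. 0)"
    then have "pull q (lin_ext (B' (Suc q)) (d' (Suc q)) w) = pull q (\<lambda>_. 0)"
      by (simp add: pull_lin_ext)
    then show "lin_ext (B' (Suc q)) (d' (Suc q)) w = (\<lambda>_. 0)"
      by (rule pull_inject) (simp_all add: lin_ext_outside')
  qed
  have fm: "w \<in> free_module (polys X) (B' p) \<longleftrightarrow>
      (\<forall>c. c \<notin> B' p \<longrightarrow> w c = 0) \<and> pull p w \<in> free_module (polys X) (B p)"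
    using pull_free_module[of p w "polys X"] by (auto simp: free_module_def)
  show ?thesis
    using fm sum diff by (cases p) (auto simp: cycles_def)
qed

lemma free_resolution_relabel:
  assumes "free_resolution X I B \<epsilon> d"
  shows "free_resolution X I B' \<epsilon>' d'"
proof -
  note res = assms[unfolded free_resolution_iff_cycles]
  have B: "finite (B p)" "b \<in> B 0 \<Longrightarrow> \<epsilon> b \<in> polys X"
    "b \<in> B (Suc p) \<Longrightarrow> d (Suc p) b \<in> free_module (polys X) (B p)" for p b
    using res by simp_all
  have "finite (B' p)" for p using B(1) bij_betw_finite[OF bij] by blast
  moreover have "\<epsilon>' c \<in> polys X" if c: "c \<in> B' 0" for c
  proof -
    obtain b where "b \<in> B 0" "c = g b" using ex_relabel[OF c] by blast
    then show ?thesis using B(2) aug_relabel by simp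
  qed
  moreover have "d' (Suc p) c \<in> free_module (polys X) (B' p)" if c: "c \<in> B' (Suc p)" for p c
  proof -
    obtain b where b: "b \<in> B (Suc p)" "c = g b" using ex_relabel[OF c] by blast
    have "d' (Suc p) c u \<in> polys X" if u: "u \<in> B' p" for u
    proof -
      obtain a where a: "a \<in> B p" "u = g a" using ex_relabel[OF u] by blast
      have "d (Suc p) b \<in> free_module (polys X) (B p)" using b(1) by (rule B(3))
      then have "d (Suc p) b a \<in> polys X" using a(1) by (simp add: free_module_def)
      then show ?thesis using diff_relabel[OF b(1) a(1)] a(2) b(2) by simp
    qed
    then show ?thesis using diff_outside'[OF c] by (simp add: free_module_def)
  qed
  moreover have "(\<lambda>w. \<Sum>c \<in> B' 0. w c * \<epsilon>' c) ` free_module (polys X) (B' 0) = I"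
  proof -
    have sum: "(\<Sum>c\<in>B' 0. w c * \<epsilon>' c) = (\<Sum>b\<in>B 0. pull 0 w b * \<epsilon> b)" for w
      by (simp add: sum_pull aug_relabel cong: sum.cong)
    have "pull 0 ` free_module (polys X) (B' 0) = free_module (polys X) (B 0)"
      using ex_pull[where p = 0 and S = "polys X"] pull_free_module[of 0 _ "polys X"]
      by (fastforce simp: free_module_def image_iff)
    then have "(\<lambda>w. \<Sum>c \<in> B' 0. w c * \<epsilon>' c) ` free_module (polys X) (B' 0)
        = (\<lambda>v. \<Sum>b \<in> B 0. v b * \<epsilon> b) ` free_module (polys X) (B 0)"
      by (simp add: sum flip: image_image[of "\<lambda>v. \<Sum>b \<in> B 0. v b * \<epsilon> b" "pull 0"])
    then show ?thesis using res by simp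
  qed
  moreover have "cycles X B' \<epsilon>' d' p = lin_ext (B' (Suc p)) (d' (Suc p)) ` free_module (polys X) (B' (Suc p))" for p
  proof -
    have "cycles X B \<epsilon> d p = lin_ext (B (Suc p)) (d (Suc p)) ` free_module (polys X) (B (Suc p))"
      using res by blast
    then show ?thesis by (intro set_eqI) (simp add: cycles_relabel boundaries_relabel)
  qed
  ultimately show ?thesis by (simp add: free_resolution_iff_cycles)
qed

lemma minimal_graded_free_resolution_relabel:
  assumes "minimal_graded_free_resolution gr X I B deg \<epsilon> d"
    and deg: "\<And>p b. b \<in> B p \<Longrightarrow> deg' p (g b) = deg p b"
  shows "minimal_graded_free_resolution gr X I B' deg' \<epsilon>' d'"
proof -
  have res: "free_resolution X I B' \<epsilon>' d'"
    using assms free_resolution_relabel by (simp add: minimal_graded_free_resolution_def)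
  have gm: "graded_maps gr B deg \<epsilon> d" and mm: "minimal_maps X B d"
    using assms(1) by (simp_all add: minimal_graded_free_resolution_def)
  have "graded_maps gr B' deg' \<epsilon>' d'"
    unfolding graded_maps_def
  proof (intro conjI allI ballI)
    fix c m assume c: "c \<in> B' 0" "m \<in> Poly_Mapping.keys (\<epsilon>' c)"
    obtain b where b: "b \<in> B 0" "c = g b" using ex_relabel[OF c(1)] by blast
    then show "gr m = deg' 0 c"
      using gm c(2) aug_relabel[OF b(1)] deg[OF b(1)] by (simp add: graded_maps_def)
  next
    fix p b' c' m
    assume h: "b' \<in> B' (Suc p)" "c' \<in> B' p" "m \<in> Poly_Mapping.keys (d' (Suc p) b' c')"
    obtain b c where b: "b \<in> B (Suc p)" "b' = g b" and c: "c \<in> B p" "c' = g c"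
      using ex_relabel h(1,2) by metis
    show "gr m + deg' p c' = deg' (Suc p) b'"
      using gm h(3) diff_relabel[OF b(1) c(1)] deg[OF b(1)] deg[OF c(1)] b c
      by (simp add: graded_maps_def)
  qed
  moreover have "minimal_maps X B' d'"
    unfolding minimal_maps_def
  proof (intro allI subsetI)
    fix p w assume "w \<in> lin_ext (B' (Suc p)) (d' (Suc p)) ` free_module (polys X) (B' (Suc p))"
    then have "\<forall>c. c \<notin> B' p \<longrightarrow> w c = 0"
      "pull p w \<in> free_module (ideal_generated (polys X) (var ` X)) (B p)"
      using boundaries_relabel mm unfolding minimal_maps_def by blast+
    then show "w \<in> free_module (ideal_generated (polys X) (var ` X)) (B' p)"
      using pull_free_module by blast
  qed
  ultimately show ?thesis using res by (simp add: minimal_graded_free_resolution_def)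
qed

end

section \<open>Gradings, minimality and the augmentation\<close>

text \<open>Injectivity of \<open>e\<close> lets coefficients be indexed by \<open>B\<close> instead
  of by generators, and generators outside the chosen finite set receive coefficient 0. It is
  applied both to the ideal of the variables and to the rainbow ideal.\<close>

lemma ideal_generated_image:
  assumes "finite B" "inj_on e B" "0 \<in> P"
  shows "ideal_generated P (e ` B) = (\<lambda>v. \<Sum>b\<in>B. v b * e b) ` free_module P B"
proof (intro equalityI subsetI)
  fix y assume "y \<in> ideal_generated P (e ` B)"
  then obtain F c where F: "F \<subseteq> e ` B" "c ` F \<subseteq> P" and y: "y = (\<Sum>f\<in>F. c f * f)"
    unfolding ideal_generated_def by blast
  let ?v = "\<lambda>b. if b \<in> B \<and> e b \<in> F then c (e b) else 0"
  have "F = e ` {b \<in> B. e b \<in> F}" using F(1) by blast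
  then have "y = (\<Sum>b\<in>{b \<in> B. e b \<in> F}. c (e b) * e b)"
    unfolding y using inj_on_subset[OF assms(2), of "{b \<in> B. e b \<in> F}"]
    by (metis (no_types, lifting) comp_apply mem_Collect_eq subsetI sum.cong sum.reindex)
  also have "\<dots> = (\<Sum>b\<in>B. ?v b * e b)"
    by (rule sum.mono_neutral_cong_left) (use assms(1) in auto)
  finally have "y = (\<Sum>b\<in>B. ?v b * e b)" .
  moreover have "?v \<in> free_module P B" using F(2) assms(3) by (auto simp: free_module_def)
  ultimately show "y \<in> (\<lambda>v. \<Sum>b\<in>B. v b * e b) ` free_module P B"
    by (rule image_eqI)
next
  fix y assume "y \<in> (\<lambda>v. \<Sum>b\<in>B. v b * e b) ` free_module P B"
  then obtain v where v: "v \<in> free_module P B" "y = (\<Sum>b\<in>B. v b * e b)" by blast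
  have "y = (\<Sum>f\<in>e ` B. v (inv_into B e f) * f)"
    using assms(2) v(2) by (simp add: sum.reindex)
  moreover have "(\<lambda>f. v (inv_into B e f)) ` (e ` B) \<subseteq> P"
    using v(1) assms(2) by (auto simp: free_module_def)
  ultimately show "y \<in> ideal_generated P (e ` B)"
    unfolding ideal_generated_def mem_Collect_eq
    by (intro exI[of _ "e ` B"] exI[of _ "\<lambda>f. v (inv_into B e f)"] conjI)
      (simp_all add: assms(1))
qed

lemma inj_var: "inj (var :: 'a \<Rightarrow> ('a, 'k::field) mpoly)"
proof (rule injI)
  fix x y :: 'a assume eq: "(var x :: ('a, 'k) mpoly) = var y"
  have "Poly_Mapping.keys (var x :: ('a, 'k) mpoly) = Poly_Mapping.keys (var y :: ('a, 'k) mpoly)"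
    using eq by simp
  then have "Poly_Mapping.single x (1::nat) = Poly_Mapping.single y 1" by (simp add: var_def)
  then have "Poly_Mapping.keys (Poly_Mapping.single x (1::nat)) = Poly_Mapping.keys (Poly_Mapping.single y (1::nat))"
    by simp
  then show "x = y" by simp
qed

context rainbow_blocks
begin

lemma bd_outside: "U \<in> faces (Suc p) \<Longrightarrow> Q \<notin> faces p \<Longrightarrow> bd U Q = (0 :: ('a, 'k::field) mpoly)"
  using bd_nonzero faces_remove by blast

text \<open>Every coefficient of a boundary is a combination of variables, as
  \<open>lin_ext_bd\<close> displays.\<close>

lemma minimal_maps_faces: "minimal_maps X faces (\<lambda>_. bd :: 'a set \<Rightarrow> 'a set \<Rightarrow> ('a, 'k::field) mpoly)"
  unfolding minimal_maps_def
proof (intro allI subsetI)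
  fix p and u :: "'a set \<Rightarrow> ('a, 'k) mpoly"
  assume "u \<in> lin_ext (faces (Suc p)) bd ` free_module (polys X) (faces (Suc p))"
  then obtain v where v: "v \<in> free_module (polys X) (faces (Suc p))" and u: "u = lin_ext (faces (Suc p)) bd v"
    by blast
  have vP: "v V \<in> polys X" for V
    using v by (cases "V \<in> faces (Suc p)") (auto simp: free_module_def)
  have "u Q \<in> ideal_generated (polys X) (var ` X)" if Q: "Q \<in> faces p" for Q
  proof -
    let ?w = "\<lambda>x. if x \<in> X - Q then (- 1) ^ rk (insert x Q) x * v (insert x Q) else 0"
    have "u Q = (\<Sum>x\<in>X - Q. (- 1) ^ rk (insert x Q) x * (v (insert x Q) * var x))"
      unfolding u by (rule lin_ext_bd[OF v faces_hits[OF Q]])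
    also have "\<dots> = (\<Sum>x\<in>X. ?w x * var x)"
      by (rule sum.mono_neutral_cong_left) (auto simp: finite_X mult.assoc)
    finally have "u Q = (\<Sum>x\<in>X. ?w x * var x)" .
    moreover have "?w \<in> free_module (polys X) X"
      using vP by (auto simp: free_module_def intro: polys_minus_one_power)
    ultimately show ?thesis
      unfolding ideal_generated_image[OF finite_X inj_on_subset[OF inj_var subset_UNIV] polys_0]
      by (rule image_eqI)
  qed
  moreover have "u Q = 0" if "Q \<notin> faces p" for Q
    using lin_ext_polys[OF free_module_hom_subset[OF bd_free_module] v] that
    unfolding u by (simp add: free_module_def)
  ultimately show "u \<in> free_module (ideal_generated (polys X) (var ` X)) (faces p)"
    by (simp add: free_module_def)
qed

text \<open>Any additive \<open>gr\<close> is allowed, which covers the fine multigrading of the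
  cellular complex and the total degree of a linear resolution at once.\<close>

lemma graded_maps_faces:
  assumes gr: "\<And>m k. gr (m + k) = gr m + gr k"
    and deg: "\<And>p U. U \<in> faces p \<Longrightarrow> deg p U = gr (set_monom U)"
  shows "graded_maps gr faces deg aug (\<lambda>_. bd :: 'a set \<Rightarrow> 'a set \<Rightarrow> ('a, 'k::field) mpoly)"
  unfolding graded_maps_def
proof (intro conjI allI ballI)
  fix U m assume "U \<in> faces 0" "m \<in> Poly_Mapping.keys (aug U :: ('a, 'k) mpoly)"
  then show "gr m = deg 0 U" by (simp add: aug_def deg)
next
  fix p U Q m
  assume U: "U \<in> faces (Suc p)" and Q: "Q \<in> faces p" and m: "m \<in> Poly_Mapping.keys (bd U Q :: ('a, 'k) mpoly)"
  then have "bd U Q \<noteq> (0 :: ('a, 'k) mpoly)" by auto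
  then obtain x where x: "hits Q" "x \<in> X - Q" "U = insert x Q" using bd_nonzero by blast
  then have xU: "x \<in> U" "U - {x} = Q" "U \<subseteq> X" "finite U"
    using faces_subset_X[OF U] finite_if_subset_X by auto
  have "bd U Q = ((- 1) ^ rk U x * var x :: ('a, 'k) mpoly)"
    using bd_remove[OF xU(3,1)] x(1) xU(2) by simp
  then have "Poly_Mapping.lookup ((- 1) ^ rk U x * var x :: ('a, 'k) mpoly) m \<noteq> 0"
    using m by (simp add: in_keys_iff)
  then have "m = Poly_Mapping.single x 1"
    by (auto simp: lookup_minus_one_power_mult var_def lookup_single when_def split: if_splits)
  then have "m + set_monom Q = set_monom U"
    using set_monom_remove[OF xU(4,1)] xU(2) by simp
  then show "gr m + deg p Q = deg (Suc p) U" by (simp add: deg[OF U] deg[OF Q] flip: gr)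
qed

lemma minimal_graded_free_resolution_faces:
  assumes "free_resolution X I faces aug (\<lambda>_. bd :: 'a set \<Rightarrow> 'a set \<Rightarrow> ('a, 'k::field) mpoly)"
    and "\<And>m k. gr (m + k) = gr m + gr k"
    and "\<And>p U. U \<in> faces p \<Longrightarrow> deg p U = gr (set_monom U)"
  shows "minimal_graded_free_resolution gr X I faces deg aug (\<lambda>_. bd :: 'a set \<Rightarrow> 'a set \<Rightarrow> ('a, 'k) mpoly)"
  unfolding minimal_graded_free_resolution_def
  by (intro conjI assms(1) minimal_maps_faces graded_maps_faces assms(2,3))

lemma has_linear_resolution_if_faces:
  fixes I :: "('a, 'k::field) mpoly set"
  assumes res: "free_resolution X I faces aug (\<lambda>_. bd)"
  shows "has_linear_resolution n X I"
proof -
  \<comment> \<open>The notion of linear resolution asks for bases of natural numbers, so the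
    finitely many subsets of \<open>X\<close> are numbered.\<close>
  obtain g :: "'a set \<Rightarrow> nat" where g: "inj_on g (Pow X)"
    using finite_imp_inj_to_nat_seg[of "Pow X"] finite_X by auto
  let ?h = "inv_into (Pow X) g"
  have h: "?h (g U) = U" if "U \<in> faces p" for U p
    using g faces_subset_X[OF that] by simp
  \<comment> \<open>The target of \<open>d' p\<close> is the basis in degree \<open>p - 1\<close>;
    entries outside it are set to zero, as the relabelling requires.\<close>
  define d' where "d' p b c = (if c \<in> g ` faces (p - 1) then bd (?h b) (?h c) else 0 :: ('a, 'k) mpoly)" for p b c
  interpret relabelling X faces aug "\<lambda>_. bd :: 'a set \<Rightarrow> 'a set \<Rightarrow> ('a, 'k) mpoly"
    "\<lambda>p. g ` faces p" "\<lambda>b. aug (?h b)" d' g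
  proof
    show "bij_betw g (faces p) (g ` faces p)" for p
      using inj_on_subset[OF g] faces_subset_X by (auto simp: bij_betw_def)
    show "bd U Q = (0 :: ('a, 'k) mpoly)" if "U \<in> faces (Suc p)" "Q \<notin> faces p" for p U Q
      using that by (rule bd_outside)
  qed (auto simp: d'_def h)
  have "minimal_graded_free_resolution total_degree X I (\<lambda>p. g ` faces p) (\<lambda>p _. n + p) (\<lambda>b. aug (?h b)) d'"
    by (rule minimal_graded_free_resolution_relabel[where deg = "\<lambda>p _. n + p"],
        rule minimal_graded_free_resolution_faces[OF res])
      (use faces_subset_X finite_if_subset_X faces_card in \<open>auto simp: total_degree_add total_degree_set_monom\<close>)
  then show ?thesis unfolding has_linear_resolution_def
    by (intro exI[of _ "\<lambda>p. g ` faces p"] exI[of _ "\<lambda>p _. n + p"] exI[of _ "\<lambda>b. aug (?h b)"] exI[of _ d']) simp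
qed

lemma rainbow_monomial_transversal:
  assumes "transversal a U"
  shows "rainbow_monomial n a = (aug (a ` {1..n}) :: ('a, 'k::field) mpoly)"
proof -
  have "inj_on a {1..n}" using transversal_card[OF assms] by (simp add: eq_card_imp_inj_on)
  then show ?thesis
    by (simp add: rainbow_monomial_def aug_def prod.reindex flip: prod_var)
qed

lemma transversal_vertex:
  assumes "U \<in> faces 0" "transversal a U"
  shows "a ` {1..n} = U"
proof (rule card_subset_eq)
  show "finite U" using faces_hits[OF assms(1)] finite_if_hits by blast
  show "a ` {1..n} \<subseteq> U" using assms(2) by (auto simp: transversal_def)
  show "card (a ` {1..n}) = card U" using transversal_card[OF assms(2)] faces_card[OF assms(1)] by simp
qed

text \<open>Elements of \<open>T\<close> correspond to the vertices of the complex: the image of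
  \<open>a\<close> is a set with one element in each block, and \<open>a\<close> can be recovered
  from it.\<close>

lemma aug_image_faces:
  assumes T: "T \<subseteq> (\<Pi>\<^sub>E i\<in>{1..n}. A i)"
  shows "rainbow_monomial n ` T = (aug ` faces 0 :: ('a, 'k::field) mpoly set)"
proof (intro equalityI subsetI)
  fix y :: "('a, 'k) mpoly" assume "y \<in> rainbow_monomial n ` T"
  then obtain a where a: "a \<in> T" "y = rainbow_monomial n a" by blast
  have aA: "a i \<in> A i" if "i \<in> {1..n}" for i using a(1) T that by (auto simp: PiE_iff)
  let ?U = "a ` {1..n}"
  have tr: "transversal a ?U" using aA by (auto simp: transversal_def)
  have "?U \<subseteq> X" using aA by (auto simp: X_def)
  then have "hits ?U" using transversal_hits[OF tr] by simp
  \<comment> \<open>Disjointness of the blocks makes the element in each block unique. Outside the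
    index set, \<open>a\<close> and \<open>b\<close> agree because both are extensional.\<close>
  moreover have "b = a" if b: "b \<in> (\<Pi>\<^sub>E i\<in>{1..n}. ?U \<inter> A i)" for b
  proof
    fix i
    show "b i = a i"
    proof (cases "i \<in> {1..n}")
      case True
      then have "b i \<in> ?U \<inter> A i" using b by (rule PiE_mem[rotated])
      then obtain j where "j \<in> {1..n}" "b i = a j" "b i \<in> A i" by blast
      then show ?thesis using same_block[of j i "a j"] aA True by metis
    next
      case False
      have "a \<in> (\<Pi>\<^sub>E i\<in>{1..n}. A i)" using a(1) T by blast
      then show ?thesis using b False by (simp add: PiE_def extensional_def)
    qed
  qed
  ultimately have "?U \<in> faces 0" using transversal_card[OF tr] a(1) by (auto simp: faces_def)
  then show "y \<in> aug ` faces 0" using rainbow_monomial_transversal[OF tr] a(2) by blast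
next
  fix y :: "('a, 'k) mpoly" assume "y \<in> aug ` faces 0"
  then obtain U where U: "U \<in> faces 0" "y = aug U" by blast
  obtain a0 where a0: "transversal a0 U" using ex_transversal[OF faces_hits[OF U(1)]] by blast
  \<comment> \<open>Restriction makes the choice extensional, as membership in \<open>T\<close>
    demands.\<close>
  define a where "a = restrict a0 {1..n}"
  have tr: "transversal a U" using a0 by (simp add: transversal_def a_def)
  have "a \<in> (\<Pi>\<^sub>E i\<in>{1..n}. U \<inter> A i)" using a0 by (auto simp: a_def transversal_def)
  then have "a \<in> T" using U(1) by (auto simp: faces_def)
  moreover have "a ` {1..n} = U" by (rule transversal_vertex[OF U(1) tr])
  ultimately show "y \<in> rainbow_monomial n ` T"
    using rainbow_monomial_transversal[OF tr] U(2) by (metis image_eqI)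
qed

lemma aug_image_ideal:
  assumes "T \<subseteq> (\<Pi>\<^sub>E i\<in>{1..n}. A i)"
  shows "(\<lambda>v. \<Sum>U\<in>faces 0. v U * aug U) ` free_module (polys X) (faces 0)
    = (rainbow_ideal n A T :: ('a, 'k::field) mpoly set)"
proof -
  have "inj_on (aug :: 'a set \<Rightarrow> ('a, 'k) mpoly) (faces 0)"
  proof (rule inj_onI)
    fix U V assume UV: "U \<in> faces 0" "V \<in> faces 0" and eq: "(aug U :: ('a, 'k) mpoly) = aug V"
    have "Poly_Mapping.keys (aug U :: ('a, 'k) mpoly) = Poly_Mapping.keys (aug V :: ('a, 'k) mpoly)"
      using eq by simp
    then have "set_monom U = set_monom V" by (simp add: aug_def)
    then show "U = V"
      by (rule set_monom_inject[OF finite_if_subset_X finite_if_subset_X, OF faces_subset_X faces_subset_X, OF UV])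
  qed
  then show ?thesis
    unfolding rainbow_ideal_def aug_image_faces[OF assms] X_def[symmetric]
    by (subst ideal_generated_image) (simp_all add: finite_faces)
qed

lemma free_resolution_faces:
  assumes "T \<subseteq> (\<Pi>\<^sub>E i\<in>{1..n}. A i)"
    and "has_linear_resolution n X (rainbow_ideal n A T :: ('a, 'k::field) mpoly set)"
  shows "free_resolution X (rainbow_ideal n A T) faces (aug :: 'a set \<Rightarrow> ('a, 'k) mpoly) (\<lambda>_. bd)"
  by (rule linear_complex.free_resolution_if_linear_resolution[OF linear_complex_faces
        const_cycle_zero aug_image_ideal[OF assms(1)] assms(2)])


section \<open>The cells as a relabelling of the faces\<close>

definition to_cell :: "'a set \<Rightarrow> nat \<Rightarrow> 'a set" where
  "to_cell U = (\<lambda>i\<in>{1..n}. U \<inter> A i)"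

definition of_cell :: "(nat \<Rightarrow> 'a set) \<Rightarrow> 'a set" where
  "of_cell R = (\<Union>i\<in>{1..n}. R i)"

lemma of_to_cell: "U \<subseteq> X \<Longrightarrow> of_cell (to_cell U) = U"
  using X_def by (auto simp: of_cell_def to_cell_def)

lemma sum_blocks:
  assumes "U \<subseteq> X"
  shows "(\<Sum>i\<in>{1..n}. \<Sum>b\<in>U \<inter> A i. f b) = sum f U"
proof -
  have "(\<Union>i\<in>{1..n}. U \<inter> A i) = U" using assms X_def by blast
  moreover have "sum f (\<Union>i\<in>{1..n}. U \<inter> A i) = (\<Sum>i\<in>{1..n}. \<Sum>b\<in>U \<inter> A i. f b)"
    using finite_if_subset_X[OF assms] same_block by (intro sum.UNION_disjoint) blast+
  ultimately show ?thesis by simp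
qed

lemma card_blocks: "U \<subseteq> X \<Longrightarrow> (\<Sum>i\<in>{1..n}. card (U \<inter> A i)) = card U"
  using sum_blocks[of U "\<lambda>_. 1::nat"] by simp

lemma to_cell_cells:
  assumes "U \<in> faces p"
  shows "to_cell U \<in> cells n A T p"
proof -
  have U: "hits U" "U \<subseteq> X" "card U = n + p" "(\<Pi>\<^sub>E i\<in>{1..n}. U \<inter> A i) \<subseteq> T"
    using assms faces_subset_X by (auto simp: faces_def)
  have "to_cell U \<in> (\<Pi>\<^sub>E i\<in>{1..n}. {Q. Q \<subseteq> A i \<and> Q \<noteq> {}})"
    using U(1) by (auto simp: to_cell_def hits_def)
  moreover have "(\<Pi>\<^sub>E i\<in>{1..n}. to_cell U i) = (\<Pi>\<^sub>E i\<in>{1..n}. U \<inter> A i)"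
    by (rule PiE_cong) (simp add: to_cell_def)
  moreover have "(\<Sum>i\<in>{1..n}. card (to_cell U i)) = card U"
    using card_blocks[OF U(2)] by (simp add: to_cell_def)
  ultimately show ?thesis using U by (simp add: cells_def cell_complex_def cell_dim_def)
qed

lemma of_cell_faces:
  assumes "R \<in> cells n A T p"
  shows "of_cell R \<in> faces p" "to_cell (of_cell R) = R"
proof -
  have R: "R \<in> (\<Pi>\<^sub>E i\<in>{1..n}. {Q. Q \<subseteq> A i \<and> Q \<noteq> {}})" "(\<Pi>\<^sub>E i\<in>{1..n}. R i) \<subseteq> T"
    "(\<Sum>i\<in>{1..n}. card (R i)) - n = p"
    using assms by (auto simp: cells_def cell_complex_def cell_dim_def)
  have RA: "R i \<subseteq> A i" "R i \<noteq> {}" if "i \<in> {1..n}" for i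
    using PiE_mem[OF R(1) that] by auto
  have part: "of_cell R \<inter> A i = R i" if "i \<in> {1..n}" for i
    using RA(1) same_block that unfolding of_cell_def by blast
  have X: "of_cell R \<subseteq> X" using RA(1) X_def by (fastforce simp: of_cell_def)
  then have h: "hits (of_cell R)" using part RA(2) by (simp add: hits_def)
  have "card (of_cell R) = (\<Sum>i\<in>{1..n}. card (R i))"
    using card_blocks[OF X] part by simp
  \<comment> \<open>The dimension is a truncated difference; \<open>hits_card\<close> excludes
    truncation.\<close>
  then have "card (of_cell R) = n + p" using R(3) hits_card[OF h] by linarith
  moreover have "(\<Pi>\<^sub>E i\<in>{1..n}. of_cell R \<inter> A i) = (\<Pi>\<^sub>E i\<in>{1..n}. R i)"
    by (rule PiE_cong) (simp only: part)
  ultimately show "of_cell R \<in> faces p" using h R(2) by (simp add: faces_def)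
  show "to_cell (of_cell R) = R"
  proof (rule extensionalityI)
    show "R \<in> extensional {1..n}" using R(1) by (simp add: PiE_def)
  qed (auto simp: to_cell_def part)
qed

lemma bij_to_cell: "bij_betw to_cell (faces p) (cells n A T p)"
  by (rule bij_betw_byWitness[where f' = of_cell])
    (auto simp: to_cell_cells of_cell_faces of_to_cell faces_subset_X)

lemma bij_of_cell: "bij_betw of_cell (cells n A T p) (faces p)"
  by (rule bij_betw_byWitness[where f' = to_cell])
    (auto simp: to_cell_cells of_cell_faces of_to_cell faces_subset_X)

lemma cell_label_to_cell: "U \<subseteq> X \<Longrightarrow> cell_label n (to_cell U) = set_monom U"
  using sum_blocks[of U "\<lambda>r. Poly_Mapping.single r 1"]
  by (simp add: cell_label_def to_cell_def set_monom_def del: One_nat_def)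

lemma cellular_aug_to_cell:
  assumes U: "U \<in> faces 0"
  shows "cellular_aug n (to_cell U) = (aug U :: ('a, 'k::field) mpoly)"
proof -
  obtain a where a: "transversal a U" using ex_transversal[OF faces_hits[OF U]] by blast
  have "to_cell U i = {a i}" if i: "i \<in> {1..n}" for i
  proof -
    have "y = a i" if y: "y \<in> U" "y \<in> A i" for y
    proof -
      obtain j where "j \<in> {1..n}" "y = a j" using y(1) transversal_vertex[OF U a] by blast
      then show ?thesis using same_block[OF _ i _ y(2)] a by (auto simp: transversal_def)
    qed
    then show ?thesis using a i by (auto simp: to_cell_def transversal_def)
  qed
  then have "transversal (\<lambda>i\<in>{1..n}. the_elem (to_cell U i)) U"
    using a by (simp add: transversal_def)
  from rainbow_monomial_transversal[OF this] transversal_vertex[OF U this] show ?thesis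
    by (simp add: cellular_aug_def)
qed

text \<open>Translates the condition in the cellular differential that a factor has at least two
  vertices.\<close>

lemma hits_remove_iff:
  assumes "hits U" "i \<in> {1..n}" "b \<in> U \<inter> A i"
  shows "hits (U - {b}) \<longleftrightarrow> card (U \<inter> A i) \<ge> 2"
proof -
  have "hits (U - {b}) \<longleftrightarrow> (U \<inter> A i) - {b} \<noteq> {}"
  proof
    assume "hits (U - {b})"
    then have "(U - {b}) \<inter> A i \<noteq> {}" using assms(2) by (simp add: hits_def)
    then show "(U \<inter> A i) - {b} \<noteq> {}" by blast
  next
    assume ne: "(U \<inter> A i) - {b} \<noteq> {}"
    have "(U - {b}) \<inter> A j \<noteq> {}" if j: "j \<in> {1..n}" for j
    proof (cases "j = i")
      case True
      then show ?thesis using ne by blast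
    next
      case False
      then have "b \<notin> A j" using same_block[OF j assms(2)] assms(3) by blast
      then show ?thesis using assms(1) j unfolding hits_def by blast
    qed
    then show "hits (U - {b})" using assms(1) by (auto simp: hits_def)
  qed
  also have "\<dots> \<longleftrightarrow> card ((U \<inter> A i) - {b}) > 0"
    using finite_if_hits[OF assms(1)] by (auto simp: card_gt_0_iff)
  also have "\<dots> \<longleftrightarrow> card (U \<inter> A i) \<ge> 2"
    using assms(3) finite_if_hits[OF assms(1)] by (simp add: card_Diff_singleton) linarith
  finally show ?thesis .
qed

lemma to_cell_remove:
  assumes "i \<in> {1..n}" "b \<in> A i"
  shows "(to_cell U)(i := to_cell U i - {b}) = to_cell (U - {b})"
proof
  fix j
  have "b \<notin> A j" if "j \<in> {1..n}" "j \<noteq> i" using same_block[OF that(1) assms(1)] assms(2) that by blast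
  then show "((to_cell U)(i := to_cell U i - {b})) j = to_cell (U - {b}) j"
    using assms(1) by (cases "j = i"; cases "j \<in> {1..n}") (auto simp: to_cell_def)
qed

section \<open>The cellular differential as the simplicial one\<close>

context
  fixes le :: "nat \<Rightarrow> 'a rel"
  assumes r: "r = block_order n A le"
begin

lemma pos_to_cell: "U \<subseteq> X \<Longrightarrow> pos n A le (to_cell U) b = rk U b"
  using of_to_cell[of U] by (simp add: pos_def rk_def of_cell_def flip: r)

text \<open>The blocks partition \<open>U\<close>, so the double sum over factors and their vertices
  collapses to one sum over \<open>U\<close>; factors with a single vertex drop out by
  \<open>hits_remove_iff\<close>.\<close>

lemma cellular_diff_to_cell:
  assumes U: "hits U"
  shows "cellular_diff n A le (to_cell U) R = (\<Sum>b\<in>U. if hits (U - {b}) \<and> R = to_cell (U - {b})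
    then (- 1) ^ rk U b * var b else (0 :: ('a, 'k::field) mpoly))" (is "_ = sum ?f U")
proof -
  have UX: "U \<subseteq> X" using U by (simp add: hits_def)
  have "cellular_diff n A le (to_cell U) R = (\<Sum>i\<in>{1..n}. \<Sum>b\<in>U \<inter> A i. ?f b)"
    unfolding cellular_diff_def
  proof (rule sum.mono_neutral_cong_left)
    show "\<forall>i\<in>{1..n} - {i \<in> {1..n}. 2 \<le> card (to_cell U i)}. (\<Sum>b\<in>U \<inter> A i. ?f b) = 0"
    proof (intro ballI sum.neutral)
      fix i b assume "i \<in> {1..n} - {i \<in> {1..n}. 2 \<le> card (to_cell U i)}" and b: "b \<in> U \<inter> A i"
      then have "i \<in> {1..n}" "\<not> 2 \<le> card (U \<inter> A i)" by (auto simp: to_cell_def)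
      then show "?f b = 0" using hits_remove_iff[OF U _ b] by simp
    qed
    fix i assume "i \<in> {i \<in> {1..n}. 2 \<le> card (to_cell U i)}"
    then have i: "i \<in> {1..n}" "2 \<le> card (U \<inter> A i)" by (auto simp: to_cell_def)
    show "(\<Sum>b\<in>to_cell U i. (- 1) ^ pos n A le (to_cell U) b * var b *
        basis_vec ((to_cell U)(i := to_cell U i - {b})) R) = (\<Sum>b\<in>U \<inter> A i. ?f b)"
    proof (rule sum.cong)
      show "to_cell U i = U \<inter> A i" using i(1) by (simp add: to_cell_def)
      fix b assume b: "b \<in> U \<inter> A i"
      have "hits (U - {b})" using hits_remove_iff[OF U i(1) b] i(2) by simp
      then show "(- 1) ^ pos n A le (to_cell U) b * var b *
          basis_vec ((to_cell U)(i := to_cell U i - {b})) R = ?f b"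
        unfolding to_cell_remove[OF i(1) IntD2[OF b]] pos_to_cell[OF UX] basis_vec_def by simp
    qed
  qed auto
  also have "\<dots> = sum ?f U" by (rule sum_blocks[OF UX])
  finally show ?thesis .
qed

lemma cellular_diff_faces:
  assumes U: "U \<in> faces (Suc p)" and Q: "Q \<in> faces p"
  shows "cellular_diff n A le (to_cell U) (to_cell Q) = (bd U Q :: ('a, 'k::field) mpoly)"
proof -
  have UX: "U \<subseteq> X" and QX: "Q \<subseteq> X" using faces_subset_X U Q by auto
  have eq: "to_cell Q = to_cell (U - {b}) \<longleftrightarrow> Q = U - {b}" for b
    using of_to_cell[OF QX] of_to_cell[of "U - {b}"] UX by (metis Diff_subset subset_trans)
  have "cellular_diff n A le (to_cell U) (to_cell Q)
      = (\<Sum>b\<in>U. if Q = U - {b} then (- 1) ^ rk U b * var b else (0 :: ('a, 'k) mpoly))"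
    unfolding cellular_diff_to_cell[OF faces_hits[OF U]] eq
    by (rule sum.cong) (use faces_hits[OF Q] in auto)
  also have "\<dots> = bd U Q"
  proof (cases "\<exists>x\<in>U. Q = U - {x}")
    case True
    then obtain x where x: "x \<in> U" "Q = U - {x}" by blast
    have "(\<Sum>b\<in>U. if Q = U - {b} then (- 1) ^ rk U b * var b else (0 :: ('a, 'k) mpoly))
        = (\<Sum>b\<in>U. if b = x then (- 1) ^ rk U x * var x else 0)"
      by (rule sum.cong) (use x in auto)
    also have "\<dots> = (- 1) ^ rk U x * var x" using x(1) finite_if_subset_X[OF UX] by simp
    also have "\<dots> = bd U Q"
      unfolding x(2) by (rule bd_remove[OF UX x(1), symmetric]) (use faces_hits[OF Q] x(2) in simp)
    finally show ?thesis .
  next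
    case False
    have "bd U Q = (0 :: ('a, 'k) mpoly)"
    proof (rule ccontr)
      assume "bd U Q \<noteq> (0 :: ('a, 'k) mpoly)"
      then obtain x where "x \<in> X - Q" "U = insert x Q" using bd_nonzero by blast
      then show False using False by auto
    qed
    moreover have "(\<Sum>b\<in>U. if Q = U - {b} then (- 1) ^ rk U b * var b else (0 :: ('a, 'k) mpoly)) = 0"
      by (rule sum.neutral) (use False in auto)
    ultimately show ?thesis by simp
  qed
  finally show ?thesis .
qed

text \<open>Facets of a cell are cells, so a nonzero entry can only occur at a cell.\<close>

lemma cellular_diff_outside:
  assumes U: "U \<in> faces (Suc p)" and R: "R \<notin> cells n A T p"
  shows "cellular_diff n A le (to_cell U) R = (0 :: ('a, 'k::field) mpoly)"
proof -
  have "U - {b} \<in> faces p" if "b \<in> U" "hits (U - {b})" for b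
    using faces_remove[of b "U - {b}" p] that U by (simp add: insert_absorb)
  then show ?thesis
    unfolding cellular_diff_to_cell[OF faces_hits[OF U]]
    using R to_cell_cells by (intro sum.neutral) auto
qed

lemma relabelling_to_cell:
  "relabelling faces (aug :: 'a set \<Rightarrow> ('a, 'k::field) mpoly) (\<lambda>_. bd)
     (cells n A T) (cellular_aug n) (\<lambda>_. cellular_diff n A le) to_cell"
proof
  show "cellular_diff n A le R R' = (0 :: ('a, 'k) mpoly)"
    if "R \<in> cells n A T (Suc p)" "R' \<notin> cells n A T p" for p R R'
    by (rule cellular_diff_outside[OF of_cell_faces(1)[OF that(1)] that(2),
          unfolded of_cell_faces(2)[OF that(1)]])
qed (simp_all add: bij_to_cell cellular_aug_to_cell cellular_diff_faces bd_outside)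

text \<open>Resolutions are transported along a relabelling in one direction, so the return from
  cells to faces needs the inverse bijection.\<close>

lemma relabelling_of_cell:
  "relabelling (cells n A T) (cellular_aug n) (\<lambda>_. cellular_diff n A le)
     faces (aug :: 'a set \<Rightarrow> ('a, 'k::field) mpoly) (\<lambda>_. bd) of_cell"
proof
  show "cellular_diff n A le R R' = (0 :: ('a, 'k) mpoly)"
    if "R \<in> cells n A T (Suc p)" "R' \<notin> cells n A T p" for p R R'
    by (rule cellular_diff_outside[OF of_cell_faces(1)[OF that(1)] that(2),
          unfolded of_cell_faces(2)[OF that(1)]])
  show "bd (of_cell R) (of_cell R') = (cellular_diff n A le R R' :: ('a, 'k) mpoly)"
    if "R \<in> cells n A T (Suc p)" "R' \<in> cells n A T p" for p R R'
    by (rule cellular_diff_faces[OF of_cell_faces(1)[OF that(1)] of_cell_faces(1)[OF that(2)],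
          unfolded of_cell_faces(2)[OF that(1)] of_cell_faces(2)[OF that(2)], symmetric])
  show "aug (of_cell R) = (cellular_aug n R :: ('a, 'k) mpoly)" if "R \<in> cells n A T 0" for R
    by (rule cellular_aug_to_cell[OF of_cell_faces(1)[OF that], unfolded of_cell_faces(2)[OF that], symmetric])
qed (simp_all add: bij_of_cell bd_outside)

text \<open>Grading and minimality hold for the faces in any case, so the property reduces to
  exactness.\<close>

lemma cellular_resolution_iff_faces:
  "cellular_complex_is_minimal_free_resolution n A le T I \<longleftrightarrow>
     free_resolution X I faces (aug :: 'a set \<Rightarrow> ('a, 'k::field) mpoly) (\<lambda>_. bd)"
  unfolding cellular_complex_is_minimal_free_resolution_def X_def[symmetric]
proof
  assume "minimal_graded_free_resolution (\<lambda>m. m) X I (cells n A T) (\<lambda>_. cell_label n)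
    (cellular_aug n :: _ \<Rightarrow> ('a, 'k) mpoly) (\<lambda>_. cellular_diff n A le)"
  then have "free_resolution X I (cells n A T) (cellular_aug n :: _ \<Rightarrow> ('a, 'k) mpoly)
      (\<lambda>_. cellular_diff n A le)"
    by (simp add: minimal_graded_free_resolution_def)
  then show "free_resolution X I faces (aug :: 'a set \<Rightarrow> ('a, 'k) mpoly) (\<lambda>_. bd)"
    by (rule relabelling.free_resolution_relabel[OF relabelling_of_cell])
next
  assume "free_resolution X I faces (aug :: 'a set \<Rightarrow> ('a, 'k) mpoly) (\<lambda>_. bd)"
  then have "minimal_graded_free_resolution (\<lambda>m. m) X I faces (\<lambda>_. set_monom)
      (aug :: 'a set \<Rightarrow> ('a, 'k) mpoly) (\<lambda>_. bd)"
    by (rule minimal_graded_free_resolution_faces) simp_all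
  then show "minimal_graded_free_resolution (\<lambda>m. m) X I (cells n A T) (\<lambda>_. cell_label n)
      (cellular_aug n :: _ \<Rightarrow> ('a, 'k) mpoly) (\<lambda>_. cellular_diff n A le)"
    by (rule relabelling.minimal_graded_free_resolution_relabel[OF relabelling_to_cell])
      (simp add: cell_label_to_cell faces_subset_X)
qed

end

end

text \<open>Elements of different blocks compare by their block indices alone, which gives
  \<open>r_block\<close>; within a block the linear order decides.\<close>

lemma rainbow_blocks_block_order:
  assumes fin: "\<And>i. i \<in> {1..n} \<Longrightarrow> finite (A i)"
    and disj: "disjoint_family_on A {1..n}"
    and lin: "\<And>i. i \<in> {1..n} \<Longrightarrow> linear_order_on (A i) (le i)"
  shows "rainbow_blocks n A (\<Union>i\<in>{1..n}. A i) (block_order n A le)"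
proof
  let ?r = "block_order n A le"
  have same: "i = j" if "i \<in> {1..n}" "j \<in> {1..n}" "x \<in> A i" "x \<in> A j" for i j x
    using disj that unfolding disjoint_family_on_def by blast
  have r_iff: "(x, y) \<in> ?r \<longleftrightarrow> i < j \<or> i = j \<and> (x, y) \<in> le i"
    if "i \<in> {1..n}" "j \<in> {1..n}" "x \<in> A i" "y \<in> A j" for i j x y
    using that same unfolding block_order_def by blast
  show "(x, y) \<in> ?r \<longleftrightarrow> (y, x) \<notin> ?r"
    if xy: "x \<in> (\<Union>i\<in>{1..n}. A i)" "y \<in> (\<Union>i\<in>{1..n}. A i)" "x \<noteq> y" for x y
  proof -
    obtain i j where i: "i \<in> {1..n}" "x \<in> A i" and j: "j \<in> {1..n}" "y \<in> A j" using xy by blast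
    have "(x, y) \<in> le i \<longleftrightarrow> (y, x) \<notin> le i" if "i = j"
      using lin[OF i(1)] i j that xy(3)
      unfolding linear_order_on_def partial_order_on_def total_on_def antisym_def by blast
    then show ?thesis unfolding r_iff[OF i(1) j(1) i(2) j(2)] r_iff[OF j(1) i(1) j(2) i(2)] by auto
  qed
  show "(x, x) \<in> ?r" if x: "x \<in> (\<Union>i\<in>{1..n}. A i)" for x
  proof -
    obtain i where i: "i \<in> {1..n}" "x \<in> A i" using x by blast
    then have "(x, x) \<in> le i"
      using lin[OF i(1)] unfolding linear_order_on_def partial_order_on_def preorder_on_def refl_on_def
      by blast
    then show ?thesis using r_iff i by blast
  qed
  show "(c, x) \<in> ?r \<longleftrightarrow> (c, y) \<in> ?r"
    if "i \<in> {1..n}" "j \<in> {1..n}" "i \<noteq> j" "x \<in> A i" "y \<in> A i" "c \<in> A j" for i j x y c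
    using r_iff[OF that(2,1,6,4)] r_iff[OF that(2,1,6,5)] that(3) by simp
qed (use fin disj in auto)

theorem theorem5p6:
  fixes n :: nat
    and A :: "nat \<Rightarrow> 'a set"
    and le :: "nat \<Rightarrow> 'a rel"
    and T :: "(nat \<Rightarrow> 'a) set"
  assumes "\<And>i. i \<in> {1..n} \<Longrightarrow> finite (A i)"
    and "\<And>i. i \<in> {1..n} \<Longrightarrow> A i \<noteq> {}"
    and "disjoint_family_on A {1..n}"
    and "\<And>i. i \<in> {1..n} \<Longrightarrow> linear_order_on (A i) (le i)"
    and "T \<subseteq> (\<Pi>\<^sub>E i\<in>{1..n}. A i)"
  shows "(has_linear_resolution n (\<Union>i\<in>{1..n}. A i)
            (rainbow_ideal n A T :: ('a, 'k::field) mpoly set) \<longrightarrow>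
          cellular_complex_is_minimal_free_resolution n A le T
            (rainbow_ideal n A T :: ('a, 'k) mpoly set)) \<and>
         (cellular_complex_is_minimal_free_resolution n A le T
            (rainbow_ideal n A T :: ('a, 'k) mpoly set) \<longleftrightarrow>
          has_linear_resolution n (\<Union>i\<in>{1..n}. A i)
            (rainbow_ideal n A T :: ('a, 'k) mpoly set))"
proof -
  interpret rainbow_blocks n A "\<Union>i\<in>{1..n}. A i" "block_order n A le" T
    by (rule rainbow_blocks_block_order) (use assms in auto)
  have "cellular_complex_is_minimal_free_resolution n A le T
      (rainbow_ideal n A T :: ('a, 'k) mpoly set) \<longleftrightarrow>
    has_linear_resolution n (\<Union>i\<in>{1..n}. A i) (rainbow_ideal n A T :: ('a, 'k) mpoly set)"
    \<comment> \<open>Here \<open>refl\<close> supplies that the abstract relation \<open>r\<close>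
      is the block order, as chosen in the interpretation.\<close>
    unfolding cellular_resolution_iff_faces[OF refl]
    using free_resolution_faces[OF assms(5)] has_linear_resolution_if_faces by blast
  then show ?thesis by blast
qed

end
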